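(* Let $S$ be a self-adjoint restriction of $T_{\max}$ (with separated boundary conditions if $\tau$ is in the limit-circle case at both endpoints), and assume that there is a real entire fundamental system $\theta_z,\phi_z$ of $(\tau-z)u=0$ with $W(\theta_z,\phi_z)=1$ such that $\phi_z$ lies in $\operatorname{dom}(S)$ near $a$. Let $\mu$ be the associated spectral measure and $\mathcal F:L^2((a,b);r(x)dx)\to L^2(\mathbb R;d\mu)$ the associated spectral transformation. Then $$S=\mathcal F^*\,\mathrm M_{\mathrm{id}}\,\mathcal F,$$ where $\mathrm M_{\mathrm{id}}$ is the maximally defined operator of multiplication by the independent variable $\lambda$ in $L^2(\mathbb R;d\mu)$.
   Context: Setting. $(a,b)\subseteq\mathbb R$ is an open interval (possibly unbounded); $p,q,r,s$ are Lebesgue measurable and real-valued a.e. on $(a,b)$, with $p^{-1},q,r,s\in L^1_{\mathrm{loc}}((a,b);dx)$, $r>0$ and $p\neq0$ a.e. For $f\in AC_{\mathrm{loc}}((a,b))$ put $f^{[1]}=p(f'+sf)$, $\mathfrak D_\tau=\{f\in AC_{\mathrm{loc}}((a,b)) : f^{[1]}\in AC_{\mathrm{loc}}((a,b))\}$, and $\tau f=\frac1r\big(-(f^{[1]})'+sf^{[1]}+qf\big)$ for $f\in\mathfrak D_\tau$. The Wronskian is $W(f,g)=fg^{[1]}-f^{[1]}g$; its limits at an endpoint exist whenever $f,g\in\mathfrak D_\tau$ and $f,\tau f,g,\tau g$ lie in $L^2$ near that endpoint. In $L^2((a,b);r(x)dx)$ the maximal operator is $T_{\max}f=\tau f$, $\operatorname{dom}(T_{\max})=\{g\in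 L^2((a,b);r\,dx): g\in\mathfrak D_\tau,\ \tau g\in L^2((a,b);r\,dx)\}$. A function lies in $L^2$ near $a$ (resp. $b$) if it lies in $L^2((a,c);r\,dx)$ (resp. $L^2((c,b);r\,dx)$) for each $c\in(a,b)$. $\tau$ is in the limit-circle case at an endpoint if for each $z\in\mathbb C$ all solutions of $(\tau-z)u=0$ lie in $L^2$ near that endpoint, and in the limit-point case if for each $z\in\mathbb C$ some solution does not. Form of $S$. $S$ is $\tau$ restricted to those $g\in\operatorname{dom}(T_{\max})$ which satisfy, at each limit-circle endpoint $c$, the boundary condition $W(g,\overline{v_c})(c)=0$, where $v_c\in\operatorname{dom}(T_{\max})$ is fixed with $W(v_c,\overline{v_c})(c)=0$ and $W(h,\overline{v_c})(c)\neq0$ for some $h\in\operatorname{dom}(T_{\max})$; no condition at limit-point endpoints. A solution $u$ of $(\tau-z)u=0$ lies in $\operatorname{dom}(S)$ near an endpoint $c$ if it lies in $L^2$ near $c$ and, when $\tau$ is limit-circle at $c$, satisfies the boundary condition of $S$ at $c$. Real entire fundamental system: for each $z\in\mathbb C$, $\theta_z,\phi_z$ are linearly independent solutions of $(\tau-z)u=0$ such that for each $x\in(a,b)$ the functions $z\mapsto\theta_z(x),\theta_z^{[1]}(x),\phi_z(x),\phi_z^{[1]}(x)$ are entire and real for $z\in\mathbb R$. The singular Weyl–Titchmarsh–Kodaira function $m:\rho(S)\to\mathbb C$ is determined by requiring that $\theta_z+m(z)\phi_z$ lies in $\operatorname{dom}(S)$ near $b$. Spectral measure and transformation. For $f\in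 L^2_c((a,b);r\,dx)$ (square integrable with compact support in $(a,b)$) put $\hat f(z)=\int_a^b\phi_z(x)f(x)\,r(x)dx$, $z\in\mathbb C$. There is a unique Borel measure $\mu$ on $\mathbb R$ given by $$\mu((\lambda_1,\lambda_2])=\lim_{\delta\downarrow0}\lim_{\varepsilon\downarrow0}\frac1\pi\int_{\lambda_1+\delta}^{\lambda_2+\delta}\operatorname{Im}\big(m(\lambda+i\varepsilon)\big)\,d\lambda,\quad\lambda_1<\lambda_2,$$ and it satisfies $dE_{f,g}=\hat f\,\overline{\hat g}\,d\mu$ for $f,g\in L^2_c((a,b);r\,dx)$, where $E_{f,g}$ is the complex measure with $\langle(S-z)^{-1}f,g\rangle=\int_{\mathbb R}(\lambda-z)^{-1}dE_{f,g}(\lambda)$ (these facts may be taken as known). Hence $f\mapsto\hat f$ extends uniquely to an isometry $\mathcal F$ from $L^2((a,b);r\,dx)$ into $L^2(\mathbb R;d\mu)$. *)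

theory Defs
  imports "HOL-Analysis.Analysis"
begin

section \<open>Locally absolutely continuous and locally integrable functions\<close>

definition abs_cont_on :: "real set \<Rightarrow> (real \<Rightarrow> complex) \<Rightarrow> bool" where
  "abs_cont_on K f \<longleftrightarrow>
     (\<forall>e>0. \<exists>d>0. \<forall>P :: (real \<times> real) set.
        finite P \<longrightarrow> (\<forall>(x, y)\<in>P. x \<le> y \<and> {x..y} \<subseteq> K) \<longrightarrow>
        pairwise (\<lambda>(x, y) (x', y'). disjnt {x<..<y} {x'<..<y'}) P \<longrightarrow>
        (\<Sum>(x, y)\<in>P. y - x) < d \<longrightarrow> (\<Sum>(x, y)\<in>P. cmod (f y - f x)) < e)"

definition AC_loc :: "real set \<Rightarrow> (real \<Rightarrow> complex) set" where
  "AC_loc I = {f. \<forall>c d. {c..d} \<subseteq> I \<longrightarrow> abs_cont_on {c..d} f}"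

definition L1_loc :: "real set \<Rightarrow> (real \<Rightarrow> real) set" where
  "L1_loc I = {f. \<forall>c d. {c..d} \<subseteq> I \<longrightarrow> f absolutely_integrable_on {c..d}}"


section \<open>Square integrable functions and operators between spaces of them\<close>

text \<open>
  Elements of a space of square integrable functions are represented by functions.  An operator is
  represented by its graph, a set of pairs of representatives that is closed under changing either
  component (within the square integrable functions) on a null set; equality of such sets is then
  equality of operators, including equality of the domains.
\<close>

definition L2 :: "real measure \<Rightarrow> (real \<Rightarrow> complex) set" where
  "L2 M = {f \<in> borel_measurable M. integrable M (\<lambda>x. (cmod (f x))\<^sup>2)}"

definition l2_inner :: "real measure \<Rightarrow> (real \<Rightarrow> complex) \<Rightarrow> (real \<Rightarrow> complex) \<Rightarrow> complex" where
  "l2_inner M f g = (\<integral>x. f x * cnj (g x) \<partial>M)"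

definition l2_norm :: "real measure \<Rightarrow> (real \<Rightarrow> complex) \<Rightarrow> real" where
  "l2_norm M f = sqrt (\<integral>x. (cmod (f x))\<^sup>2 \<partial>M)"

type_synonym l2_graph = "((real \<Rightarrow> complex) \<times> (real \<Rightarrow> complex)) set"

definition adjoint_graph :: "real measure \<Rightarrow> real measure \<Rightarrow> l2_graph \<Rightarrow> l2_graph" where
  "adjoint_graph M N T =
     {(g, k). g \<in> L2 N \<and> k \<in> L2 M \<and> (\<forall>(f, h)\<in>T. l2_inner N h g = l2_inner M f k)}"

definition densely_defined :: "real measure \<Rightarrow> l2_graph \<Rightarrow> bool" where
  "densely_defined M T \<longleftrightarrow>
     (\<forall>f\<in>L2 M. \<forall>e>0. \<exists>g\<in>Domain T. l2_norm M (\<lambda>x. f x - g x) < e)"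

definition self_adjoint :: "real measure \<Rightarrow> l2_graph \<Rightarrow> bool" where
  "self_adjoint M T \<longleftrightarrow> densely_defined M T \<and> adjoint_graph M M T = T"

text \<open>The graph of \<open>(T - z)\<^sup>-\<^sup>1\<close>.\<close>

definition resolvent_graph :: "l2_graph \<Rightarrow> complex \<Rightarrow> l2_graph" where
  "resolvent_graph T z = {(g, f). (f, \<lambda>x. g x + z * f x) \<in> T}"

definition resolvent_set :: "real measure \<Rightarrow> l2_graph \<Rightarrow> complex set" where
  "resolvent_set M T =
     {z. (\<forall>g\<in>L2 M. \<exists>f. (g, f) \<in> resolvent_graph T z) \<and>
         (\<forall>g f f'. (g, f) \<in> resolvent_graph T z \<longrightarrow> (g, f') \<in> resolvent_graph T z \<longrightarrow>
                   (AE x in M. f x = f' x)) \<and>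
         (\<exists>C. \<forall>(g, f)\<in>resolvent_graph T z. l2_norm M f \<le> C * l2_norm M g)}"

definition mult_id :: "real measure \<Rightarrow> l2_graph" where
  "mult_id \<mu> = {(G, H). G \<in> L2 \<mu> \<and> H \<in> L2 \<mu> \<and> (AE l in \<mu>. H l = of_real l * G l)}"

text \<open>
  For a map between representatives that respects equality almost everywhere, the graph of the
  induced operator.
\<close>

definition graph_of ::
    "real measure \<Rightarrow> real measure \<Rightarrow> ((real \<Rightarrow> complex) \<Rightarrow> real \<Rightarrow> complex) \<Rightarrow> l2_graph" where
  "graph_of M N F = {(f, G). f \<in> L2 M \<and> G \<in> L2 N \<and> (AE x in N. G x = F f x)}"

definition linear_isometry ::
    "real measure \<Rightarrow> real measure \<Rightarrow> ((real \<Rightarrow> complex) \<Rightarrow> real \<Rightarrow> complex) \<Rightarrow> bool" where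
  "linear_isometry M N F \<longleftrightarrow>
     (\<forall>f\<in>L2 M. F f \<in> L2 N \<and> l2_norm N (F f) = l2_norm M f) \<and>
     (\<forall>f\<in>L2 M. \<forall>g\<in>L2 M. \<forall>c d. AE x in N.
        F (\<lambda>t. c * f t + d * g t) x = c * F f x + d * F g x)"

text \<open>
  \<open>w d\<mu>\<close> is the complex measure \<open>E\<close> with
  \<open>\<langle>(T - z)\<^sup>-\<^sup>1 f, g\<rangle> = \<integral> (l - z)\<^sup>-\<^sup>1 dE(l)\<close>.  For self-adjoint \<open>T\<close> every
  non-real \<open>z\<close> is in the resolvent set, and these \<open>z\<close> already determine \<open>E\<close>.
\<close>

definition spectral_density ::
    "real measure \<Rightarrow> l2_graph \<Rightarrow> (real \<Rightarrow> complex) \<Rightarrow> (real \<Rightarrow> complex) \<Rightarrow>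
     real measure \<Rightarrow> (real \<Rightarrow> complex) \<Rightarrow> bool" where
  "spectral_density M T f g \<mu> w \<longleftrightarrow>
     integrable \<mu> w \<and>
     (\<forall>z h. Im z \<noteq> 0 \<longrightarrow> (f, h) \<in> resolvent_graph T z \<longrightarrow>
            l2_inner M h g = (\<integral>l. inverse (of_real l - z) * w l \<partial>\<mu>))"


section \<open>The Sturm--Liouville differential expression\<close>

record sl_data =
  sl_a :: ereal
  sl_b :: ereal
  sl_p :: "real \<Rightarrow> real"
  sl_q :: "real \<Rightarrow> real"
  sl_r :: "real \<Rightarrow> real"
  sl_s :: "real \<Rightarrow> real"

definition sl_interval :: "sl_data \<Rightarrow> real set" where
  "sl_interval D = einterval (sl_a D) (sl_b D)"

definition sl_hypotheses :: "sl_data \<Rightarrow> bool" where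
  "sl_hypotheses D \<longleftrightarrow>
     sl_a D < sl_b D \<and>
     {sl_p D, sl_q D, sl_r D, sl_s D} \<subseteq> borel_measurable (lebesgue_on (sl_interval D)) \<and>
     {\<lambda>x. inverse (sl_p D x), sl_q D, sl_r D, sl_s D} \<subseteq> L1_loc (sl_interval D) \<and>
     (AE x in lebesgue_on (sl_interval D). sl_r D x > 0 \<and> sl_p D x \<noteq> 0)"

definition sl_measure_on :: "sl_data \<Rightarrow> real set \<Rightarrow> real measure" where
  "sl_measure_on D A = density (lebesgue_on A) (\<lambda>x. ennreal (sl_r D x))"

abbreviation sl_measure :: "sl_data \<Rightarrow> real measure" where
  "sl_measure D \<equiv> sl_measure_on D (sl_interval D)"

text \<open>
  The expression \<open>p (f' + s f)\<close> only makes sense almost everywhere, so \<open>f\<^sup>[\<^sup>1\<^sup>]\<close> being locally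
  absolutely continuous means that it has a locally absolutely continuous representative.  Two such
  representatives agree everywhere in the interval, so that the choice made below does not matter
  there.
\<close>

definition is_quasi_deriv :: "sl_data \<Rightarrow> (real \<Rightarrow> complex) \<Rightarrow> (real \<Rightarrow> complex) \<Rightarrow> bool" where
  "is_quasi_deriv D f g \<longleftrightarrow>
     g \<in> AC_loc (sl_interval D) \<and>
     (AE x in lebesgue_on (sl_interval D).
        g x = of_real (sl_p D x) * (vector_derivative f (at x) + of_real (sl_s D x) * f x))"

definition quasi_deriv :: "sl_data \<Rightarrow> (real \<Rightarrow> complex) \<Rightarrow> real \<Rightarrow> complex" where
  "quasi_deriv D f = (SOME g. is_quasi_deriv D f g)"

definition sl_functions :: "sl_data \<Rightarrow> (real \<Rightarrow> complex) set" where
  "sl_functions D = {f \<in> AC_loc (sl_interval D). \<exists>g. is_quasi_deriv D f g}"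

definition tau :: "sl_data \<Rightarrow> (real \<Rightarrow> complex) \<Rightarrow> real \<Rightarrow> complex" where
  "tau D f x = (1 / of_real (sl_r D x)) *
     (- vector_derivative (quasi_deriv D f) (at x)
      + of_real (sl_s D x) * quasi_deriv D f x + of_real (sl_q D x) * f x)"

definition wronskian ::
    "sl_data \<Rightarrow> (real \<Rightarrow> complex) \<Rightarrow> (real \<Rightarrow> complex) \<Rightarrow> real \<Rightarrow> complex" where
  "wronskian D f g x = f x * quasi_deriv D g x - quasi_deriv D f x * g x"

definition sl_solution :: "sl_data \<Rightarrow> complex \<Rightarrow> (real \<Rightarrow> complex) \<Rightarrow> bool" where
  "sl_solution D z u \<longleftrightarrow>
     u \<in> sl_functions D \<and> (AE x in lebesgue_on (sl_interval D). tau D u x = z * u x)"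

definition dom_max :: "sl_data \<Rightarrow> (real \<Rightarrow> complex) set" where
  "dom_max D = {g \<in> sl_functions D. g \<in> L2 (sl_measure D) \<and> tau D g \<in> L2 (sl_measure D)}"


section \<open>Endpoints and boundary conditions\<close>

datatype endpoint = Lower | Upper

fun endpoint_filter :: "sl_data \<Rightarrow> endpoint \<Rightarrow> real filter" where
  "endpoint_filter D Lower = filtermap real_of_ereal (at_right (sl_a D))"
| "endpoint_filter D Upper = filtermap real_of_ereal (at_left (sl_b D))"

fun endpoint_part :: "sl_data \<Rightarrow> endpoint \<Rightarrow> real \<Rightarrow> real set" where
  "endpoint_part D Lower c = einterval (sl_a D) (ereal c)"
| "endpoint_part D Upper c = einterval (ereal c) (sl_b D)"

definition L2_near :: "sl_data \<Rightarrow> endpoint \<Rightarrow> (real \<Rightarrow> complex) set" where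
  "L2_near D e = {f. \<forall>c\<in>sl_interval D. f \<in> L2 (sl_measure_on D (endpoint_part D e c))}"

definition limit_circle :: "sl_data \<Rightarrow> endpoint \<Rightarrow> bool" where
  "limit_circle D e \<longleftrightarrow> (\<forall>z u. sl_solution D z u \<longrightarrow> u \<in> L2_near D e)"

definition wronskian_limit ::
    "sl_data \<Rightarrow> endpoint \<Rightarrow> (real \<Rightarrow> complex) \<Rightarrow> (real \<Rightarrow> complex) \<Rightarrow> complex \<Rightarrow> bool" where
  "wronskian_limit D e f g L \<longleftrightarrow> (wronskian D f g \<longlongrightarrow> L) (endpoint_filter D e)"

definition boundary_function :: "sl_data \<Rightarrow> endpoint \<Rightarrow> (real \<Rightarrow> complex) \<Rightarrow> bool" where
  "boundary_function D e v \<longleftrightarrow>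
     v \<in> dom_max D \<and> wronskian_limit D e v (\<lambda>x. cnj (v x)) 0 \<and>
     (\<exists>h\<in>dom_max D. \<exists>L. L \<noteq> 0 \<and> wronskian_limit D e h (\<lambda>x. cnj (v x)) L)"

text \<open>
  \<open>v\<close> assigns to each endpoint the function that defines the boundary condition there; its value
  is irrelevant at endpoints that are not limit-circle.
\<close>

definition boundary_condition ::
    "sl_data \<Rightarrow> (endpoint \<Rightarrow> real \<Rightarrow> complex) \<Rightarrow> endpoint \<Rightarrow> (real \<Rightarrow> complex) \<Rightarrow> bool" where
  "boundary_condition D v e g \<longleftrightarrow>
     (limit_circle D e \<longrightarrow> wronskian_limit D e g (\<lambda>x. cnj (v e x)) 0)"

definition sl_operator :: "sl_data \<Rightarrow> (endpoint \<Rightarrow> real \<Rightarrow> complex) \<Rightarrow> l2_graph" where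
  "sl_operator D v =
     {(f, g). f \<in> L2 (sl_measure D) \<and> g \<in> L2 (sl_measure D) \<and>
        (\<exists>h\<in>dom_max D. (\<forall>e. boundary_condition D v e h) \<and>
           (AE x in sl_measure D. f x = h x) \<and> (AE x in sl_measure D. g x = tau D h x))}"

definition in_dom_near ::
    "sl_data \<Rightarrow> (endpoint \<Rightarrow> real \<Rightarrow> complex) \<Rightarrow> endpoint \<Rightarrow> (real \<Rightarrow> complex) \<Rightarrow> bool" where
  "in_dom_near D v e u \<longleftrightarrow> u \<in> L2_near D e \<and> boundary_condition D v e u"


section \<open>Weyl--Titchmarsh--Kodaira function, spectral measure, spectral transformation\<close>

definition real_entire :: "(complex \<Rightarrow> complex) \<Rightarrow> bool" where
  "real_entire f \<longleftrightarrow> f holomorphic_on UNIV \<and> (\<forall>l::real. f (of_real l) \<in> \<real>)"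

definition real_entire_system ::
    "sl_data \<Rightarrow> (complex \<Rightarrow> real \<Rightarrow> complex) \<Rightarrow> (complex \<Rightarrow> real \<Rightarrow> complex) \<Rightarrow> bool" where
  "real_entire_system D \<theta> \<phi> \<longleftrightarrow>
     (\<forall>z. sl_solution D z (\<theta> z) \<and> sl_solution D z (\<phi> z) \<and>
        (\<forall>c d. (\<forall>x\<in>sl_interval D. c * \<theta> z x + d * \<phi> z x = 0) \<longrightarrow> c = 0 \<and> d = 0)) \<and>
     (\<forall>x\<in>sl_interval D.
        real_entire (\<lambda>z. \<theta> z x) \<and> real_entire (\<lambda>z. quasi_deriv D (\<theta> z) x) \<and>
        real_entire (\<lambda>z. \<phi> z x) \<and> real_entire (\<lambda>z. quasi_deriv D (\<phi> z) x))"

definition weyl_function ::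
    "sl_data \<Rightarrow> (endpoint \<Rightarrow> real \<Rightarrow> complex) \<Rightarrow> (complex \<Rightarrow> real \<Rightarrow> complex) \<Rightarrow>
     (complex \<Rightarrow> real \<Rightarrow> complex) \<Rightarrow> (complex \<Rightarrow> complex) \<Rightarrow> bool" where
  "weyl_function D v \<theta> \<phi> m \<longleftrightarrow>
     (\<forall>z\<in>resolvent_set (sl_measure D) (sl_operator D v).
        in_dom_near D v Upper (\<lambda>x. \<theta> z x + m z * \<phi> z x))"

text \<open>The auxiliary function \<open>J\<close> is the inner one of the two iterated limits.\<close>

definition spectral_measure :: "(complex \<Rightarrow> complex) \<Rightarrow> real measure \<Rightarrow> bool" where
  "spectral_measure m \<mu> \<longleftrightarrow>
     sets \<mu> = sets borel \<and>
     (\<forall>l1 l2. l1 < l2 \<longrightarrow> emeasure \<mu> {l1<..l2} < \<infinity> \<and>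
        (\<exists>J. (\<forall>\<^sub>F d in at_right 0.
                ((\<lambda>e. 1 / pi * (LBINT l:{l1 + d..l2 + d}. Im (m (Complex l e)))) \<longlongrightarrow> J d)
                  (at_right 0)) \<and>
             (J \<longlongrightarrow> measure \<mu> {l1<..l2}) (at_right 0)))"

definition L2_c :: "sl_data \<Rightarrow> (real \<Rightarrow> complex) set" where
  "L2_c D = {f \<in> L2 (sl_measure D). \<exists>K. compact K \<and> K \<subseteq> sl_interval D \<and>
               (AE x in sl_measure D. x \<notin> K \<longrightarrow> f x = 0)}"

definition hat ::
    "sl_data \<Rightarrow> (complex \<Rightarrow> real \<Rightarrow> complex) \<Rightarrow> (real \<Rightarrow> complex) \<Rightarrow> complex \<Rightarrow> complex" where
  "hat D \<phi> f z = (\<integral>x. \<phi> z x * f x \<partial>sl_measure D)"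

definition spectral_transformation ::
    "sl_data \<Rightarrow> (complex \<Rightarrow> real \<Rightarrow> complex) \<Rightarrow> real measure \<Rightarrow>
     ((real \<Rightarrow> complex) \<Rightarrow> real \<Rightarrow> complex) \<Rightarrow> bool" where
  "spectral_transformation D \<phi> \<mu> F \<longleftrightarrow>
     linear_isometry (sl_measure D) \<mu> F \<and>
     (\<forall>f\<in>L2_c D. AE l in \<mu>. F f l = hat D \<phi> f (of_real l))"

end

theory Submission
  imports Defs
begin

text \<open>
  By density of the compactly supported functions, the known formula for the resolvent says that
  \<open>(S - \<i>)\<^sup>-\<^sup>1\<close> is the compression \<open>\<F>\<^sup>* R \<F>\<close> of the multiplication \<open>R\<close> by
  \<open>(\<lambda> - \<i>)\<^sup>-\<^sup>1\<close>.  Since \<open>\<parallel>(S - \<i>)\<^sup>-\<^sup>1 f\<parallel>\<^sup>2 = Im \<langle>(S - \<i>)\<^sup>-\<^sup>1 f, f\<rangle> = \<parallel>R \<F> f\<parallel>\<^sup>2\<close>, this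
  compression loses no norm, which forces \<open>\<F> (S - \<i>)\<^sup>-\<^sup>1 = R \<F>\<close>.  Hence \<open>\<F> S \<subseteq> M\<^sub>i\<^sub>d \<F>\<close>, and so
  \<open>S \<subseteq> \<F>\<^sup>* M\<^sub>i\<^sub>d \<F>\<close>; surjectivity of \<open>\<F>\<close> plays no role.  The right-hand side is symmetric, so it
  cannot properly extend the self-adjoint operator \<open>S\<close>.
\<close>

section \<open>The space of square integrable functions\<close>

lemma L2_measurable [measurable_dest]: "f \<in> L2 M \<Longrightarrow> f \<in> borel_measurable M"
  by (simp add: L2_def)

lemma L2_integrable: "f \<in> L2 M \<Longrightarrow> integrable M (\<lambda>x. (cmod (f x))\<^sup>2)"
  by (simp add: L2_def)

lemma borel_measurable_cnj [measurable (raw)]: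
  "f \<in> borel_measurable M \<Longrightarrow> (\<lambda>x. cnj (f x)) \<in> borel_measurable M"
  by (rule borel_measurable_continuous_on[of cnj]) (intro continuous_intros)

lemma L2_bound:
  assumes "f \<in> L2 M" "g \<in> borel_measurable M" "\<And>x. x \<in> space M \<Longrightarrow> cmod (g x) \<le> cmod (f x)"
  shows "g \<in> L2 M"
  unfolding L2_def
proof (safe intro!: assms(2))
  note [measurable] = assms(2)
  show "integrable M (\<lambda>x. (cmod (g x))\<^sup>2)"
    by (rule Bochner_Integration.integrable_bound[OF L2_integrable[OF assms(1)]])
       (auto intro!: AE_I2 power_mono assms(3))
qed

lemma L2_scale: "f \<in> L2 M \<Longrightarrow> (\<lambda>x. c * f x) \<in> L2 M"
  by (auto simp: L2_def norm_mult power_mult_distrib)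

lemma norm_add_power2_le: "(norm (a + b :: 'a :: real_normed_vector))\<^sup>2 \<le> 2 * (norm a)\<^sup>2 + 2 * (norm b)\<^sup>2"
proof -
  have "(norm (a + b))\<^sup>2 \<le> (norm a + norm b)\<^sup>2"
    by (intro power_mono norm_triangle_ineq) auto
  also have "\<dots> \<le> 2 * (norm a)\<^sup>2 + 2 * (norm b)\<^sup>2"
    using zero_le_power2[of "norm a - norm b"] by (simp add: power2_eq_square algebra_simps)
  finally show ?thesis .
qed

lemma L2_add:
  assumes "f \<in> L2 M" "g \<in> L2 M"
  shows "(\<lambda>x. f x + g x) \<in> L2 M"
proof -
  note [measurable] = assms
  have "integrable M (\<lambda>x. 2 * (cmod (f x))\<^sup>2 + 2 * (cmod (g x))\<^sup>2)"
    using assms by (auto simp: L2_def)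
  then have "integrable M (\<lambda>x. (cmod (f x + g x))\<^sup>2)"
    by (rule Bochner_Integration.integrable_bound)
       (auto intro!: AE_I2 order_trans[OF norm_add_power2_le])
  then show ?thesis
    using assms by (simp add: L2_def)
qed

lemma L2_diff: "f \<in> L2 M \<Longrightarrow> g \<in> L2 M \<Longrightarrow> (\<lambda>x. f x - g x) \<in> L2 M"
  using L2_add[OF _ L2_scale[of g M "-1"], of f] by simp

lemma L2_lincomb: "f \<in> L2 M \<Longrightarrow> g \<in> L2 M \<Longrightarrow> (\<lambda>x. c * f x + d * g x) \<in> L2 M"
  by (intro L2_add L2_scale)

lemma L2_zero: "(\<lambda>x. 0) \<in> L2 M"
  by (simp add: L2_def)

lemma L2_prod_integrable:
  assumes "f \<in> L2 M" "g \<in> L2 M"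
  shows "integrable M (\<lambda>x. f x * cnj (g x))"
proof -
  note [measurable] = assms
  have "integrable M (\<lambda>x. (cmod (f x))\<^sup>2 + (cmod (g x))\<^sup>2)"
    using assms by (auto simp: L2_def)
  then show ?thesis
  proof (rule Bochner_Integration.integrable_bound)
    show "AE x in M. norm (f x * cnj (g x)) \<le> norm ((cmod (f x))\<^sup>2 + (cmod (g x))\<^sup>2)"
    proof (rule AE_I2)
      fix x
      have "2 * (cmod (f x) * cmod (g x)) \<le> (cmod (f x))\<^sup>2 + (cmod (g x))\<^sup>2"
        using sum_squares_bound[of "cmod (f x)" "cmod (g x)"] by simp
      moreover have "0 \<le> cmod (f x) * cmod (g x)" by simp
      ultimately have "cmod (f x) * cmod (g x) \<le> (cmod (f x))\<^sup>2 + (cmod (g x))\<^sup>2"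
        by linarith
      then show "norm (f x * cnj (g x)) \<le> norm ((cmod (f x))\<^sup>2 + (cmod (g x))\<^sup>2)"
        by (simp add: norm_mult)
    qed
  qed simp
qed

section \<open>Inner product, norm expansion, the Cauchy-Schwarz inequality and completeness\<close>

lemma l2_inner_lincomb_left:
  assumes "f \<in> L2 M" "g \<in> L2 M" "h \<in> L2 M"
  shows "l2_inner M (\<lambda>x. c * f x + d * g x) h = c * l2_inner M f h + d * l2_inner M g h"
  using L2_prod_integrable[of f M h] L2_prod_integrable[of g M h] assms
  by (simp add: l2_inner_def distrib_right mult.assoc)

lemma l2_inner_sym: "l2_inner M g f = cnj (l2_inner M f g)"
  by (simp add: l2_inner_def flip: Bochner_Integration.integral_cnj) (simp add: mult.commute)

lemma l2_inner_lincomb_right: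
  assumes "f \<in> L2 M" "g \<in> L2 M" "h \<in> L2 M"
  shows "l2_inner M h (\<lambda>x. c * f x + d * g x) = cnj c * l2_inner M h f + cnj d * l2_inner M h g"
  using l2_inner_lincomb_left[OF assms, of c d]
  by (subst (1 2 3) l2_inner_sym) simp

lemmas l2_inner_diff_right = l2_inner_lincomb_right[where c = 1 and d = "-1", simplified]

lemma l2_inner_cong:
  assumes "f \<in> L2 M" "f' \<in> L2 M" "g \<in> L2 M" "g' \<in> L2 M"
    and "AE x in M. f x = f' x" "AE x in M. g x = g' x"
  shows "l2_inner M f g = l2_inner M f' g'"
proof -
  note [measurable] = assms(1-4)
  show ?thesis
    unfolding l2_inner_def using assms(5,6) by (intro integral_cong_AE) auto
qed

lemma l2_norm_cong:
  assumes "f \<in> L2 M" "g \<in> L2 M" "AE x in M. f x = g x"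
  shows "l2_norm M f = l2_norm M g"
proof -
  note [measurable] = assms(1,2)
  have "(\<integral>x. (cmod (f x))\<^sup>2 \<partial>M) = (\<integral>x. (cmod (g x))\<^sup>2 \<partial>M)"
    using assms(3) by (intro integral_cong_AE) auto
  then show ?thesis
    by (simp add: l2_norm_def)
qed

lemma l2_norm_nonneg [simp]: "0 \<le> l2_norm M f"
  by (simp add: l2_norm_def)

lemma l2_norm_power2: "(l2_norm M f)\<^sup>2 = (\<integral>x. (cmod (f x))\<^sup>2 \<partial>M)"
  by (simp add: l2_norm_def)

lemma l2_inner_self: "l2_inner M f f = of_real ((l2_norm M f)\<^sup>2)"
  unfolding l2_norm_power2 l2_inner_def complex_norm_square[symmetric] integral_complex_of_real ..

text \<open>One expansion with free complex coefficients serves the Cauchy-Schwarz inequality, the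
  projection argument and polarization below, each through its own choice of \<open>c\<close> and
  \<open>d\<close>.\<close>

lemma l2_norm_lincomb_power2:
  assumes "f \<in> L2 M" "g \<in> L2 M"
  shows "(l2_norm M (\<lambda>x. c * f x + d * g x))\<^sup>2 =
    (cmod c)\<^sup>2 * (l2_norm M f)\<^sup>2 + (cmod d)\<^sup>2 * (l2_norm M g)\<^sup>2 + 2 * Re (c * cnj d * l2_inner M f g)"
    (is "?lhs = ?rhs")
proof -
  have "complex_of_real ?lhs = l2_inner M (\<lambda>x. c * f x + d * g x) (\<lambda>x. c * f x + d * g x)"
    by (simp add: l2_inner_self)
  also have "\<dots> = c * cnj c * l2_inner M f f + d * cnj d * l2_inner M g g
      + (c * cnj d * l2_inner M f g + cnj (c * cnj d * l2_inner M f g))"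
    using l2_inner_sym[of M g f]
    by (simp add: l2_inner_lincomb_left l2_inner_lincomb_right L2_lincomb assms algebra_simps)
  also have "\<dots> = of_real ?rhs"
    unfolding complex_add_cnj
    by (simp add: l2_inner_self complex_norm_square[symmetric])
  finally show ?thesis
    using of_real_eq_iff by blast
qed

lemma l2_norm_diff_power2:
  assumes "f \<in> L2 M" "g \<in> L2 M"
  shows "(l2_norm M (\<lambda>x. f x - g x))\<^sup>2 = (l2_norm M f)\<^sup>2 + (l2_norm M g)\<^sup>2 - 2 * Re (l2_inner M f g)"
  using l2_norm_lincomb_power2[OF assms, of 1 "-1"] by simp

lemma l2_norm_scale: "l2_norm M (\<lambda>x. c * f x) = cmod c * l2_norm M f"
  by (simp add: l2_norm_def norm_mult power_mult_distrib real_sqrt_mult)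

lemma l2_norm_minus_commute: "l2_norm M (\<lambda>x. f x - g x) = l2_norm M (\<lambda>x. g x - f x)"
  by (simp add: l2_norm_def norm_minus_commute)

lemma l2_norm_eq_0_iff:
  assumes "f \<in> L2 M"
  shows "l2_norm M f = 0 \<longleftrightarrow> (AE x in M. f x = 0)"
  using integral_nonneg_eq_0_iff_AE[OF L2_integrable[OF assms]] by (simp add: l2_norm_def)

lemma l2_Cauchy_Schwarz:
  assumes f: "f \<in> L2 M" and g: "g \<in> L2 M"
  shows "cmod (l2_inner M f g) \<le> l2_norm M f * l2_norm M g"
proof (cases "l2_norm M f = 0")
  case True
  then have "AE x in M. f x = 0"
    using l2_norm_eq_0_iff[OF f] by simp
  then have "l2_inner M f g = 0"
    unfolding l2_inner_def by (intro integral_eq_zero_AE) auto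
  then show ?thesis
    using True by simp
next
  case False
  define n where "n = l2_norm M f"
  define w where "w = l2_inner M f g"
  have n: "n > 0"
    using False by (simp add: n_def order_less_le)
  \<comment> \<open>This combination is \<open>n^2\<close> times the component of \<open>g\<close>
    orthogonal to \<open>f\<close>: since \<open>w\<close> is \<open>l2_inner M f g\<close>, the
    projection of \<open>g\<close> onto \<open>f\<close> is \<open>cnj w / n^2\<close> times
    \<open>f\<close>. The factor \<open>n^2\<close> clears the denominator.\<close>
  have "0 \<le> (l2_norm M (\<lambda>x. (- cnj w) * f x + of_real (n\<^sup>2) * g x))\<^sup>2"
    by simp
  also have "\<dots> = (cmod w)\<^sup>2 * n\<^sup>2 + n ^ 4 * (l2_norm M g)\<^sup>2 - 2 * n\<^sup>2 * Re (cnj w * w)"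
    by (subst l2_norm_lincomb_power2[OF f g])
       (simp add: n_def[symmetric] w_def[symmetric] norm_power algebra_simps flip: power_mult)
  also have "Re (cnj w * w) = (cmod w)\<^sup>2"
    by (simp add: mult.commute[of "cnj w"] complex_norm_square[symmetric] del: of_real_power)
  finally have "n\<^sup>2 * (cmod w)\<^sup>2 \<le> n\<^sup>2 * (n * l2_norm M g)\<^sup>2"
    by (simp add: power_mult_distrib algebra_simps power2_eq_square power4_eq_xxxx)
  then have "(cmod w)\<^sup>2 \<le> (n * l2_norm M g)\<^sup>2"
    using n by simp
  then show ?thesis
    using n by (auto simp: n_def w_def intro: power2_le_imp_le)
qed

lemma l2_norm_triangle_add:
  assumes f: "f \<in> L2 M" and g: "g \<in> L2 M"
  shows "l2_norm M (\<lambda>x. f x + g x) \<le> l2_norm M f + l2_norm M g"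
proof (rule power2_le_imp_le)
  have "Re (l2_inner M f g) \<le> l2_norm M f * l2_norm M g"
    using l2_Cauchy_Schwarz[OF f g] complex_Re_le_cmod order_trans by blast
  then show "(l2_norm M (\<lambda>x. f x + g x))\<^sup>2 \<le> (l2_norm M f + l2_norm M g)\<^sup>2"
    using l2_norm_lincomb_power2[OF f g, of 1 1] by (simp add: power2_sum)
qed simp

lemma l2_dist_triangle:
  assumes "f \<in> L2 M" "g \<in> L2 M" "h \<in> L2 M"
  shows "l2_norm M (\<lambda>x. f x - h x) \<le> l2_norm M (\<lambda>x. f x - g x) + l2_norm M (\<lambda>x. g x - h x)"
  using l2_norm_triangle_add[OF L2_diff[OF assms(1,2)] L2_diff[OF assms(2,3)]] by simp

text \<open>Along a subsequence with \<open>\<parallel>X\<^bsub>r(k+1)\<^esub> - X\<^bsub>r k\<^esub>\<parallel>\<^sup>2 \<le> 8\<^sup>-\<^sup>k\<close> the series of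
  \<open>4\<^sup>k |X\<^bsub>r(k+1)\<^esub> - X\<^bsub>r k\<^esub>|\<^sup>2\<close> is integrable, so the subsequence is pointwise Cauchy a.e.;
  Fatou's lemma then identifies its pointwise limit as the limit in norm.\<close>

lemma L2_complete:
  assumes X: "\<And>n. X n \<in> L2 M"
    and Cauchy: "\<And>e. e > 0 \<Longrightarrow> \<exists>N. \<forall>m\<ge>N. \<forall>n\<ge>N. l2_norm M (\<lambda>x. X m x - X n x) < e"
  shows "\<exists>f\<in>L2 M. (\<lambda>n. l2_norm M (\<lambda>x. X n x - f x)) \<longlonglongrightarrow> 0"
proof -
  note [measurable] = X
  have nn: "(\<integral>\<^sup>+x. ennreal ((cmod (X m x - X n x))\<^sup>2) \<partial>M)
      = ennreal ((l2_norm M (\<lambda>x. X m x - X n x))\<^sup>2)" for m n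
    unfolding l2_norm_power2
    by (rule nn_integral_eq_integral) (auto intro!: L2_integrable L2_diff X)
  have "\<exists>N. \<forall>m\<ge>N. \<forall>n\<ge>N. l2_norm M (\<lambda>x. X m x - X n x) < sqrt ((1/8) ^ k)" for k :: nat
    by (rule Cauchy) simp
  then obtain N where N: "\<And>k m n. m \<ge> N k \<Longrightarrow> n \<ge> N k \<Longrightarrow>
      l2_norm M (\<lambda>x. X m x - X n x) < sqrt ((1/8) ^ k)"
    by metis
  \<comment> \<open>The partial sum of \<open>N\<close> puts both \<open>r k\<close> and
    \<open>r (Suc k)\<close> beyond \<open>N k\<close>, and the summand \<open>k\<close> makes the
    indices tend to infinity.\<close>
  define r where "r k = k + (\<Sum>i\<le>k. N i)" for k
  have r_N: "N k \<le> r k" for k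
    unfolding r_def by (intro trans_le_add2 member_le_sum) auto
  have r_Suc: "N k \<le> r (Suc k)" for k
    using r_N[of k] by (simp add: r_def)
  have r_ge: "k \<le> r k" for k
    by (simp add: r_def)
  define d where "d k x = (cmod (X (r (Suc k)) x - X (r k) x))\<^sup>2" for k x
  have d_meas [measurable]: "d k \<in> borel_measurable M" for k
    unfolding d_def by measurable
  have int_d: "(\<integral>\<^sup>+x. ennreal (4 ^ k * d k x) \<partial>M) \<le> ennreal ((1/2) ^ k)" for k
  proof -
    have "(\<integral>\<^sup>+x. ennreal (4 ^ k * d k x) \<partial>M) = ennreal (4 ^ k) * (\<integral>\<^sup>+x. ennreal (d k x) \<partial>M)"
      by (simp add: ennreal_mult' nn_integral_cmult)
    also have "\<dots> = ennreal (4 ^ k * (l2_norm M (\<lambda>x. X (r (Suc k)) x - X (r k) x))\<^sup>2)"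
      by (simp add: d_def nn ennreal_mult')
    also have "\<dots> \<le> ennreal (4 ^ k * (1/8) ^ k)"
    proof (intro ennreal_leI mult_left_mono)
      have "(l2_norm M (\<lambda>x. X (r (Suc k)) x - X (r k) x))\<^sup>2 \<le> (sqrt ((1/8) ^ k))\<^sup>2"
        by (intro power_mono less_imp_le[OF N] r_N r_Suc) simp
      then show "(l2_norm M (\<lambda>x. X (r (Suc k)) x - X (r k) x))\<^sup>2 \<le> (1/8) ^ k"
        by simp
    qed simp
    also have "4 ^ k * (1/8) ^ k = (1/2 :: real) ^ k"
      by (simp flip: power_mult_distrib)
    finally show ?thesis .
  qed
  have "(\<integral>\<^sup>+x. (\<Sum>k. ennreal (4 ^ k * d k x)) \<partial>M) = (\<Sum>k. \<integral>\<^sup>+x. ennreal (4 ^ k * d k x) \<partial>M)"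
    by (rule nn_integral_suminf) simp
  also have "\<dots> \<le> (\<Sum>k. ennreal ((1/2) ^ k))"
    by (intro suminf_le int_d) auto
  also have "\<dots> < \<infinity>"
    by (subst suminf_ennreal2) auto
  finally have "AE x in M. (\<Sum>k. ennreal (4 ^ k * d k x)) \<noteq> \<infinity>"
    by (intro nn_integral_PInf_AE) auto
  then have conv: "AE x in M. convergent (\<lambda>k. X (r k) x)"
  proof eventually_elim
    case (elim x)
    have "\<And>k. 0 \<le> 4 ^ k * d k x"
      by (simp add: d_def)
    then have "summable (\<lambda>k. 4 ^ k * d k x)"
      using elim by (intro summable_suminf_not_top) auto
    \<comment> \<open>Boundedness of the terms is enough: \<open>4 ^ k * d k x \<le> B\<close>
      bounds the increment at \<open>k\<close> by \<open>sqrt B * (1/2) ^ k\<close>, the term of a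
      geometric series.\<close>
    then have "Bseq (\<lambda>k. 4 ^ k * d k x)"
      by (meson convergent_imp_Bseq convergentI summable_LIMSEQ_zero)
    then obtain B where B: "B > 0" "\<And>k. 4 ^ k * d k x \<le> B"
      by (auto simp: Bseq_def d_def)
    have "summable (\<lambda>k. X (r (Suc k)) x - X (r k) x)"
    proof (rule summable_comparison_test')
      show "summable (\<lambda>k. sqrt B * (1/2) ^ k)"
        by (intro summable_mult summable_geometric) simp
      fix k
      have "(2 ^ k * cmod (X (r (Suc k)) x - X (r k) x))\<^sup>2 \<le> B"
        using B(2)[of k] by (simp add: d_def power_mult_distrib power2_eq_square[of "2 ^ k"]
            flip: power_mult_distrib[of 2 2])
      then have "2 ^ k * cmod (X (r (Suc k)) x - X (r k) x) \<le> sqrt B"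
        by (rule real_le_rsqrt)
      then show "cmod (X (r (Suc k)) x - X (r k) x) \<le> sqrt B * (1/2) ^ k"
        by (simp add: field_simps)
    qed
    then have "convergent (\<lambda>n. \<Sum>k<n. X (r (Suc k)) x - X (r k) x)"
      by (simp add: summable_iff_convergent)
    then have "convergent (\<lambda>n. X (r n) x - X (r 0) x)"
      by (simp add: sum_lessThan_telescope[of "\<lambda>n. X (r n) x"])
    then show ?case
      using convergent_add[OF _ convergent_const[of "X (r 0) x"]] by fastforce
  qed
  define f where "f x = lim (\<lambda>k. X (r k) x)" for x
  have f_meas [measurable]: "f \<in> borel_measurable M"
    unfolding f_def by measurable
  have lim: "AE x in M. (\<lambda>k. X (r k) x) \<longlonglongrightarrow> f x"
    using conv by (simp add: f_def convergent_LIMSEQ_iff)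
  \<comment> \<open>Used twice: with \<open>e = 1\<close> and \<open>n = N1\<close> it puts
    \<open>X N1 - f\<close>, hence \<open>f\<close>, into \<open>L2 M\<close>; with
    \<open>e / 2\<close> it gives convergence in norm, halved because the limit keeps only a weak
    inequality.\<close>
  have Fatou: "(\<integral>\<^sup>+x. ennreal ((cmod (X n x - f x))\<^sup>2) \<partial>M) \<le> ennreal (e\<^sup>2)"
    if e: "e > 0" "\<And>m. m \<ge> K \<Longrightarrow> l2_norm M (\<lambda>x. X n x - X m x) < e" for n e K
  proof -
    have "(\<integral>\<^sup>+x. ennreal ((cmod (X n x - f x))\<^sup>2) \<partial>M)
        = (\<integral>\<^sup>+x. liminf (\<lambda>k. ennreal ((cmod (X n x - X (r k) x))\<^sup>2)) \<partial>M)"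
    proof (rule nn_integral_cong_AE)
      show "AE x in M. ennreal ((cmod (X n x - f x))\<^sup>2)
          = liminf (\<lambda>k. ennreal ((cmod (X n x - X (r k) x))\<^sup>2))"
        using lim
      proof eventually_elim
        case (elim x)
        have "(\<lambda>k. ennreal ((cmod (X n x - X (r k) x))\<^sup>2)) \<longlonglongrightarrow> ennreal ((cmod (X n x - f x))\<^sup>2)"
          by (intro tendsto_intros elim)
        then show ?case
          using lim_imp_Liminf[OF sequentially_bot] by metis
      qed
    qed
    also have "\<dots> \<le> liminf (\<lambda>k. \<integral>\<^sup>+x. ennreal ((cmod (X n x - X (r k) x))\<^sup>2) \<partial>M)"
      by (rule nn_integral_liminf) simp
    also have "\<dots> \<le> ennreal (e\<^sup>2)"
    proof (rule Liminf_le)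
      show "\<forall>\<^sub>F k in sequentially. (\<integral>\<^sup>+x. ennreal ((cmod (X n x - X (r k) x))\<^sup>2) \<partial>M) \<le> ennreal (e\<^sup>2)"
        using eventually_ge_at_top[of K]
      proof eventually_elim
        case (elim k)
        then have "l2_norm M (\<lambda>x. X n x - X (r k) x) < e"
          using r_ge[of k] by (intro e) auto
        then show ?case
          unfolding nn by (intro ennreal_leI power_mono) auto
      qed
    qed simp
    finally show ?thesis .
  qed
  obtain N1 where N1: "\<And>m n. m \<ge> N1 \<Longrightarrow> n \<ge> N1 \<Longrightarrow> l2_norm M (\<lambda>x. X m x - X n x) < 1"
    using Cauchy[of 1] by auto
  have "(\<integral>\<^sup>+x. ennreal ((cmod (X N1 x - f x))\<^sup>2) \<partial>M) < \<infinity>"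
    using Fatou[of 1 N1 N1] N1 by (auto intro: le_less_trans)
  then have "(\<lambda>x. X N1 x - f x) \<in> L2 M"
    by (auto simp: L2_def intro!: integrableI_bounded)
  from L2_diff[OF X[of N1] this] have f: "f \<in> L2 M"
    by simp
  have "(\<lambda>n. l2_norm M (\<lambda>x. X n x - f x)) \<longlonglongrightarrow> 0"
  proof (rule LIMSEQ_I)
    fix e :: real assume "e > 0"
    then obtain K where K: "\<And>m n. m \<ge> K \<Longrightarrow> n \<ge> K \<Longrightarrow> l2_norm M (\<lambda>x. X m x - X n x) < e / 2"
      using Cauchy[of "e / 2"] by auto
    have "l2_norm M (\<lambda>x. X n x - f x) \<le> e / 2" if "n \<ge> K" for n
    proof (rule power2_le_imp_le)
      have "ennreal ((l2_norm M (\<lambda>x. X n x - f x))\<^sup>2) = (\<integral>\<^sup>+x. ennreal ((cmod (X n x - f x))\<^sup>2) \<partial>M)"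
        unfolding l2_norm_power2
        by (rule nn_integral_eq_integral[symmetric]) (auto intro!: L2_integrable L2_diff X f)
      also have "\<dots> \<le> ennreal ((e / 2)\<^sup>2)"
        using \<open>e > 0\<close> K[OF that] by (intro Fatou[of _ K]) auto
      finally show "(l2_norm M (\<lambda>x. X n x - f x))\<^sup>2 \<le> (e / 2)\<^sup>2"
        by (simp add: ennreal_le_iff)
    qed (use \<open>e > 0\<close> in simp)
    then show "\<exists>no. \<forall>n\<ge>no. norm (l2_norm M (\<lambda>x. X n x - f x) - 0) < e"
      using \<open>e > 0\<close> by (intro exI[of _ K]) force
  qed
  with f show ?thesis
    by blast
qed

section \<open>Continuity of the inner product and orthogonal projection\<close>

lemma l2_inner_tendsto:
  assumes X: "\<And>n. X n \<in> L2 M" and f: "f \<in> L2 M" and g: "g \<in> L2 M"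
    and lim: "(\<lambda>n. l2_norm M (\<lambda>x. X n x - f x)) \<longlonglongrightarrow> 0"
  shows "(\<lambda>n. l2_inner M g (X n)) \<longlonglongrightarrow> l2_inner M g f"
proof (rule LIM_zero_cancel, rule Lim_null_comparison)
  show "\<forall>\<^sub>F n in sequentially. norm (l2_inner M g (X n) - l2_inner M g f)
      \<le> l2_norm M g * l2_norm M (\<lambda>x. X n x - f x)"
    using l2_Cauchy_Schwarz[OF g L2_diff[OF X f]]
    by (simp add: l2_inner_diff_right X f g)
  show "(\<lambda>n. l2_norm M g * l2_norm M (\<lambda>x. X n x - f x)) \<longlonglongrightarrow> 0"
    using tendsto_mult_left[OF lim] by simp
qed

text \<open>The projection is the nearest point: a minimizing sequence for the distance to
  \<open>u\<close> is Cauchy by the parallelogram law, and its limit stays in \<open>V\<close> by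
  closedness. Varying the minimizer inside \<open>V\<close> shows that the error is orthogonal to
  \<open>V\<close>.\<close>

lemma L2_projection:
  assumes V: "V \<subseteq> L2 M" "V \<noteq> {}"
    and lincomb: "\<And>y w c d. y \<in> V \<Longrightarrow> w \<in> V \<Longrightarrow> (\<lambda>x. c * y x + d * w x) \<in> V"
    and closed: "\<And>Y y. (\<And>n. Y n \<in> V) \<Longrightarrow> y \<in> L2 M \<Longrightarrow>
      (\<lambda>n. l2_norm M (\<lambda>x. Y n x - y x)) \<longlonglongrightarrow> 0 \<Longrightarrow> y \<in> V"
    and u: "u \<in> L2 M"
  shows "\<exists>y\<in>V. \<forall>w\<in>V. l2_inner M (\<lambda>x. u x - y x) w = 0"
proof -
  define \<delta> where "\<delta> = (INF y\<in>V. (l2_norm M (\<lambda>x. u x - y x))\<^sup>2)"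
  have bdd: "bdd_below ((\<lambda>y. (l2_norm M (\<lambda>x. u x - y x))\<^sup>2) ` V)"
    by (rule bdd_belowI2[of _ 0]) simp
  have \<delta>: "\<delta> \<le> (l2_norm M (\<lambda>x. u x - y x))\<^sup>2" if "y \<in> V" for y
    unfolding \<delta>_def by (rule cINF_lower[OF bdd that])
  have "\<exists>y\<in>V. (l2_norm M (\<lambda>x. u x - y x))\<^sup>2 < \<delta> + 1 / real (Suc n)" for n
  proof -
    have "\<delta> < \<delta> + 1 / real (Suc n)"
      by simp
    then show ?thesis
      using cINF_less_iff[OF V(2) bdd] unfolding \<delta>_def by blast
  qed
  then obtain Y where Y: "\<And>n. Y n \<in> V"
    and Y_less: "\<And>n. (l2_norm M (\<lambda>x. u x - Y n x))\<^sup>2 < \<delta> + 1 / real (Suc n)"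
    by metis
  have L2: "y \<in> L2 M" if "y \<in> V" for y
    using V that by auto
  have dist: "(l2_norm M (\<lambda>x. Y m x - Y n x))\<^sup>2 \<le> 2 / real (Suc m) + 2 / real (Suc n)" for m n
  proof -
    \<comment> \<open>The midpoint of \<open>Y m\<close> and \<open>Y n\<close> lies in
      \<open>V\<close>, which bounds the squared norm of \<open>a + b\<close> below by
      \<open>4 * \<delta>\<close>; the parallelogram law then leaves at most
      \<open>2 / Suc m + 2 / Suc n\<close> for that of \<open>b - a\<close>.\<close>
    define a b where "a = (\<lambda>x. u x - Y m x)" and "b = (\<lambda>x. u x - Y n x)"
    have ab: "a \<in> L2 M" "b \<in> L2 M"
      unfolding a_def b_def by (auto intro: L2_diff u L2 Y)
    have "\<delta> \<le> (l2_norm M (\<lambda>x. u x - (1/2 * Y m x + 1/2 * Y n x)))\<^sup>2"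
      by (intro \<delta> lincomb Y)
    also have "(\<lambda>x. u x - (1/2 * Y m x + 1/2 * Y n x)) = (\<lambda>x. 1/2 * a x + 1/2 * b x)"
      by (auto simp: a_def b_def field_simps)
    finally have "4 * \<delta> \<le> (l2_norm M a)\<^sup>2 + (l2_norm M b)\<^sup>2 + 2 * Re (l2_inner M a b)"
      by (subst (asm) l2_norm_lincomb_power2[OF ab]) (simp add: power2_eq_square)
    moreover have "(l2_norm M (\<lambda>x. b x - a x))\<^sup>2 =
        (l2_norm M a)\<^sup>2 + (l2_norm M b)\<^sup>2 - 2 * Re (l2_inner M a b)"
      using l2_norm_diff_power2[OF ab] l2_norm_minus_commute[of M a b] by simp
    moreover have "(l2_norm M a)\<^sup>2 < \<delta> + 1 / real (Suc m)" "(l2_norm M b)\<^sup>2 < \<delta> + 1 / real (Suc n)"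
      using Y_less by (simp_all add: a_def b_def)
    moreover have "(\<lambda>x. Y m x - Y n x) = (\<lambda>x. b x - a x)"
      by (simp add: a_def b_def)
    ultimately show ?thesis
      by simp
  qed
  have "\<exists>y\<in>L2 M. (\<lambda>n. l2_norm M (\<lambda>x. Y n x - y x)) \<longlonglongrightarrow> 0"
  proof (rule L2_complete)
    fix e :: real assume "e > 0"
    then obtain N where N: "1 / real (Suc N) < e\<^sup>2 / 4"
      using nat_approx_posE[of "e\<^sup>2 / 4"] by auto
    have "l2_norm M (\<lambda>x. Y m x - Y n x) < e" if "m \<ge> N" "n \<ge> N" for m n
    proof (rule power2_less_imp_less)
      have "1 / real (Suc m) \<le> 1 / real (Suc N)" "1 / real (Suc n) \<le> 1 / real (Suc N)"
        using that by (auto intro!: divide_left_mono)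
      then show "(l2_norm M (\<lambda>x. Y m x - Y n x))\<^sup>2 < e\<^sup>2"
        using dist[of m n] N by simp
    qed (use \<open>e > 0\<close> in simp)
    then show "\<exists>N. \<forall>m\<ge>N. \<forall>n\<ge>N. l2_norm M (\<lambda>x. Y m x - Y n x) < e"
      by blast
  qed (intro L2 Y)
  then obtain y where y: "y \<in> L2 M" and lim: "(\<lambda>n. l2_norm M (\<lambda>x. Y n x - y x)) \<longlonglongrightarrow> 0"
    by blast
  have yV: "y \<in> V"
    by (rule closed[OF Y y lim])
  define p where "p = (\<lambda>x. u x - y x)"
  have p: "p \<in> L2 M"
    unfolding p_def by (intro L2_diff u y)
  have "l2_norm M p \<le> sqrt \<delta>"
  proof (rule LIMSEQ_le_const)
    have "(\<lambda>n. sqrt (\<delta> + 1 / real (Suc n)) + l2_norm M (\<lambda>x. Y n x - y x)) \<longlonglongrightarrow> sqrt (\<delta> + 0) + 0"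
      by (intro tendsto_intros lim LIMSEQ_Suc[OF lim_1_over_n])
    then show "(\<lambda>n. sqrt (\<delta> + 1 / real (Suc n)) + l2_norm M (\<lambda>x. Y n x - y x)) \<longlonglongrightarrow> sqrt \<delta>"
      by simp
    have "l2_norm M p \<le> sqrt (\<delta> + 1 / real (Suc n)) + l2_norm M (\<lambda>x. Y n x - y x)" for n
      using l2_dist_triangle[OF u L2[OF Y[of n]] y] real_le_rsqrt[OF less_imp_le[OF Y_less[of n]]]
      unfolding p_def by linarith
    then show "\<exists>N. \<forall>n\<ge>N. l2_norm M p \<le> sqrt (\<delta> + 1 / real (Suc n)) + l2_norm M (\<lambda>x. Y n x - y x)"
      by blast
  qed
  moreover have "0 \<le> \<delta>"
    unfolding \<delta>_def by (intro cINF_greatest V) simp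
  ultimately have p_le: "(l2_norm M p)\<^sup>2 \<le> \<delta>"
    by (metis l2_norm_nonneg power_mono real_sqrt_pow2)
  have "l2_inner M p w = 0" if w: "w \<in> V" for w
  proof -
    define A where "A = l2_inner M p w"
    \<comment> \<open>Moving \<open>y\<close> by \<open>t * A\<close> times \<open>w\<close> changes
      the squared distance by \<open>(cmod A)^2 * t * (t * (l2_norm M w)^2 - 2)\<close>, so a
      nonzero \<open>A\<close> would beat the minimum if \<open>t > 0\<close> and
      \<open>t * (l2_norm M w)^2 < 2\<close>. The summand 1 keeps \<open>t\<close> positive when
      \<open>w\<close> vanishes almost everywhere.\<close>
    define t where "t = 1 / ((l2_norm M w)\<^sup>2 + 1)"
    have pos: "0 < (l2_norm M w)\<^sup>2 + 1"
      by (simp add: add_nonneg_pos)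
    have "\<delta> \<le> (l2_norm M (\<lambda>x. u x - (1 * y x + (of_real t * A) * w x)))\<^sup>2"
      by (intro \<delta> lincomb yV w)
    also have "(\<lambda>x. u x - (1 * y x + (of_real t * A) * w x)) = (\<lambda>x. 1 * p x + (- (of_real t * A)) * w x)"
      by (auto simp: p_def)
    also have "(l2_norm M \<dots>)\<^sup>2 = (l2_norm M p)\<^sup>2 + t\<^sup>2 * (cmod A)\<^sup>2 * (l2_norm M w)\<^sup>2 - 2 * t * Re (cnj A * A)"
      by (subst l2_norm_lincomb_power2[OF p L2[OF w]])
         (simp add: A_def[symmetric] norm_mult power_mult_distrib algebra_simps)
    also have "Re (cnj A * A) = (cmod A)\<^sup>2"
      by (simp add: mult.commute[of "cnj A"] complex_norm_square[symmetric] del: of_real_power)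
    finally have "0 \<le> (cmod A)\<^sup>2 * (t * (t * (l2_norm M w)\<^sup>2 - 2))"
      using p_le by (simp add: power2_eq_square algebra_simps)
    moreover have "t * (l2_norm M w)\<^sup>2 - 2 < 0" "t > 0"
      using pos by (auto simp: t_def field_simps)
    then have "t * (t * (l2_norm M w)\<^sup>2 - 2) < 0"
      by (intro mult_pos_neg)
    ultimately have "(cmod A)\<^sup>2 \<le> 0"
      by (metis mult_pos_neg not_le)
    then show ?thesis
      by (simp add: A_def)
  qed
  then show ?thesis
    using yV unfolding p_def by blast
qed

section \<open>Self-adjoint operators\<close>

lemma self_adjointD:
  assumes "self_adjoint M T" "(f, h) \<in> T"
  shows "f \<in> L2 M" "h \<in> L2 M"
  using assms unfolding self_adjoint_def adjoint_graph_def by auto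

lemma self_adjoint_symmetric:
  assumes "self_adjoint M T" "(f, h) \<in> T" "(g, k) \<in> T"
  shows "l2_inner M h g = l2_inner M f k"
proof -
  have "(g, k) \<in> adjoint_graph M M T"
    using assms by (simp add: self_adjoint_def)
  then show ?thesis
    using assms(2) by (auto simp: adjoint_graph_def)
qed

text \<open>Self-adjointness as a membership test: by \<open>adjoint_graph M M T = T\<close>, a pair
  is in the graph as soon as it is symmetric against all of \<open>T\<close>. Linearity, invariance
  under null sets and closedness of \<open>T\<close> all follow through this test.\<close>

lemma self_adjointI:
  assumes "self_adjoint M T" "f \<in> L2 M" "h \<in> L2 M"
    and "\<And>x y. (x, y) \<in> T \<Longrightarrow> l2_inner M y f = l2_inner M x h"
  shows "(f, h) \<in> T"
proof -
  have "(f, h) \<in> adjoint_graph M M T"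
    using assms by (auto simp: adjoint_graph_def)
  then show ?thesis
    using assms(1) by (simp add: self_adjoint_def)
qed

lemma self_adjoint_zero: "self_adjoint M T \<Longrightarrow> (\<lambda>x. 0, \<lambda>x. 0) \<in> T"
  by (rule self_adjointI) (auto simp: L2_zero l2_inner_def)

lemma self_adjoint_lincomb:
  assumes T: "self_adjoint M T" and fh: "(f, h) \<in> T" and gk: "(g, k) \<in> T"
  shows "(\<lambda>x. c * f x + d * g x, \<lambda>x. c * h x + d * k x) \<in> T"
proof (rule self_adjointI[OF T])
  note L2 = self_adjointD[OF T fh] self_adjointD[OF T gk]
  show "(\<lambda>x. c * f x + d * g x) \<in> L2 M" "(\<lambda>x. c * h x + d * k x) \<in> L2 M"
    by (intro L2_lincomb L2)+
  fix x y assume xy: "(x, y) \<in> T"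
  show "l2_inner M y (\<lambda>t. c * f t + d * g t) = l2_inner M x (\<lambda>t. c * h t + d * k t)"
    using self_adjoint_symmetric[OF T xy fh] self_adjoint_symmetric[OF T xy gk]
    by (simp add: l2_inner_lincomb_right L2 self_adjointD[OF T xy])
qed

lemma self_adjoint_AE_cong:
  assumes T: "self_adjoint M T" and fh: "(f, h) \<in> T" and "f' \<in> L2 M" "h' \<in> L2 M"
    and "AE x in M. f x = f' x" "AE x in M. h x = h' x"
  shows "(f', h') \<in> T"
proof (rule self_adjointI[OF T assms(3,4)])
  fix x y assume xy: "(x, y) \<in> T"
  note L2 = self_adjointD[OF T fh] self_adjointD[OF T xy]
  have "l2_inner M y f' = l2_inner M y f" "l2_inner M x h' = l2_inner M x h"
    using assms(3-6) L2 by (auto intro!: l2_inner_cong)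
  then show "l2_inner M y f' = l2_inner M x h'"
    using self_adjoint_symmetric[OF T xy fh] by simp
qed

text \<open>Both sides of the symmetry relation are continuous in the pair, so the relation survives
  the limit.\<close>

lemma self_adjoint_closed:
  assumes T: "self_adjoint M T" and XY: "\<And>n. (X n, Y n) \<in> T"
    and f: "f \<in> L2 M" "(\<lambda>n. l2_norm M (\<lambda>x. X n x - f x)) \<longlonglongrightarrow> 0"
    and h: "h \<in> L2 M" "(\<lambda>n. l2_norm M (\<lambda>x. Y n x - h x)) \<longlonglongrightarrow> 0"
  shows "(f, h) \<in> T"
proof (rule self_adjointI[OF T f(1) h(1)])
  fix x y assume xy: "(x, y) \<in> T"
  note L2 = self_adjointD[OF T XY] self_adjointD[OF T xy]
  have "(\<lambda>n. l2_inner M y (X n)) \<longlonglongrightarrow> l2_inner M y f"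
    by (intro l2_inner_tendsto L2 f)
  moreover have "(\<lambda>n. l2_inner M y (X n)) \<longlonglongrightarrow> l2_inner M x h"
    unfolding self_adjoint_symmetric[OF T xy XY] by (intro l2_inner_tendsto L2 h)
  ultimately show "l2_inner M y f = l2_inner M x h"
    by (rule LIMSEQ_unique)
qed

text \<open>Writing \<open>h\<close> for \<open>T f\<close>, \<open>y\<close> is
  \<open>h - \<i> f\<close>, and \<open>l2_inner M h f\<close> is real by symmetry. Hence the cross
  term in the squared norm of \<open>y\<close> vanishes, which gives the contraction bound, and the
  imaginary part of \<open>l2_inner M f y\<close> comes from \<open>\<i> * l2_inner M f f\<close>
  alone.\<close>

lemma self_adjoint_resolvent_i:
  assumes T: "self_adjoint M T" and yf: "(y, f) \<in> resolvent_graph T \<i>"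
  shows "f \<in> L2 M" "y \<in> L2 M" "(\<lambda>x. y x + \<i> * f x) \<in> L2 M"
    "l2_norm M f \<le> l2_norm M y"
    "Im (l2_inner M f y) = (l2_norm M f)\<^sup>2"
proof -
  define h where "h = (\<lambda>x. y x + \<i> * f x)"
  have fh: "(f, h) \<in> T"
    using yf by (simp add: resolvent_graph_def h_def)
  note L2 = self_adjointD[OF T fh]
  have y: "y = (\<lambda>x. 1 * h x + (- \<i>) * f x)"
    by (simp add: h_def)
  have real: "l2_inner M h f = cnj (l2_inner M h f)"
    using self_adjoint_symmetric[OF T fh fh] by (simp add: l2_inner_sym[of M f h])
  then have Im: "Im (l2_inner M h f) = 0"
    by (metis complex_cnj_cancel_iff Reals_cnj_iff complex_is_Real_iff)
  show "f \<in> L2 M" "(\<lambda>x. y x + \<i> * f x) \<in> L2 M"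
    using L2 by (simp_all add: h_def)
  show "y \<in> L2 M"
    unfolding y by (intro L2_lincomb L2)
  have norm: "(l2_norm M y)\<^sup>2 = (l2_norm M f)\<^sup>2 + (l2_norm M h)\<^sup>2"
    unfolding y by (subst l2_norm_lincomb_power2) (use L2 Im in auto)
  show "l2_norm M f \<le> l2_norm M y"
    by (rule power2_le_imp_le) (simp_all add: norm)
  have "l2_inner M f y = l2_inner M f h + \<i> * l2_inner M f f"
    unfolding y by (subst l2_inner_lincomb_right) (use L2 in auto)
  then show "Im (l2_inner M f y) = (l2_norm M f)\<^sup>2"
    using Im by (simp add: l2_inner_sym[of M f h] l2_inner_self)
qed

section \<open>Linearity of the resolvent and surjectivity of \<open>T - \<i>\<close>\<close>

lemma resolvent_graph_lincomb:
  assumes T: "self_adjoint M T" and "(y, f) \<in> resolvent_graph T z" "(w, g) \<in> resolvent_graph T z"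
  shows "(\<lambda>x. c * y x + d * w x, \<lambda>x. c * f x + d * g x) \<in> resolvent_graph T z"
  using self_adjoint_lincomb[OF T, of f "\<lambda>x. y x + z * f x" g "\<lambda>x. w x + z * g x" c d] assms(2,3)
  by (simp add: resolvent_graph_def algebra_simps)

lemmas resolvent_graph_diff = resolvent_graph_lincomb[where c = 1 and d = "-1", simplified]

lemma l2_tendsto_add:
  assumes "\<And>n. X n \<in> L2 M" "f \<in> L2 M" "\<And>n. Y n \<in> L2 M" "g \<in> L2 M"
    and "(\<lambda>n. l2_norm M (\<lambda>x. X n x - f x)) \<longlonglongrightarrow> 0" "(\<lambda>n. l2_norm M (\<lambda>x. Y n x - g x)) \<longlonglongrightarrow> 0"
  shows "(\<lambda>n. l2_norm M (\<lambda>x. (X n x + Y n x) - (f x + g x))) \<longlonglongrightarrow> 0"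
proof (rule Lim_null_comparison)
  show "\<forall>\<^sub>F n in sequentially. norm (l2_norm M (\<lambda>x. (X n x + Y n x) - (f x + g x)))
      \<le> l2_norm M (\<lambda>x. X n x - f x) + l2_norm M (\<lambda>x. Y n x - g x)"
    using l2_norm_triangle_add[OF L2_diff[OF assms(1,2)] L2_diff[OF assms(3,4)]]
    by (simp add: algebra_simps)
  show "(\<lambda>n. l2_norm M (\<lambda>x. X n x - f x) + l2_norm M (\<lambda>x. Y n x - g x)) \<longlonglongrightarrow> 0"
    using tendsto_add[OF assms(5,6)] by simp
qed

text \<open>The range \<open>V\<close> of \<open>T - \<i>\<close> is closed, because the contraction
  bound makes the preimages of a convergent sequence Cauchy and \<open>T\<close> is closed. The part
  \<open>p\<close> of \<open>u\<close> orthogonal to \<open>V\<close> satisfies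
  \<open>T p = - \<i> * p\<close> by self-adjointness, and a symmetric operator has no nonzero
  eigenvector with a non-real eigenvalue.\<close>

lemma self_adjoint_resolvent_i_surj:
  assumes T: "self_adjoint M T" and u: "u \<in> L2 M"
  shows "\<exists>f. (u, f) \<in> resolvent_graph T \<i>"
proof -
  define V where "V = Domain (resolvent_graph T \<i>)"
  have "\<exists>y\<in>V. \<forall>w\<in>V. l2_inner M (\<lambda>x. u x - y x) w = 0"
  proof (rule L2_projection[OF _ _ _ _ u])
    show "V \<subseteq> L2 M"
      unfolding V_def using self_adjoint_resolvent_i(2)[OF T] by auto
    have "(\<lambda>x. 0, \<lambda>x. 0) \<in> resolvent_graph T \<i>"
      using self_adjoint_zero[OF T] by (simp add: resolvent_graph_def)
    then show "V \<noteq> {}"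
      unfolding V_def by blast
    show "(\<lambda>x. c * y x + d * w x) \<in> V" if "y \<in> V" "w \<in> V" for y w c d
      using that resolvent_graph_lincomb[OF T] unfolding V_def by blast
  next
    fix Y y
    assume Y: "\<And>n. Y n \<in> V" and y: "y \<in> L2 M"
      and lim: "(\<lambda>n. l2_norm M (\<lambda>x. Y n x - y x)) \<longlonglongrightarrow> 0"
    obtain X where X: "\<And>n. (Y n, X n) \<in> resolvent_graph T \<i>"
      using Y unfolding V_def Domain_iff by metis
    note L2 = self_adjoint_resolvent_i(1-3)[OF T X]
    have le: "l2_norm M (\<lambda>x. X m x - X n x) \<le> l2_norm M (\<lambda>x. Y m x - Y n x)" for m n
      by (rule self_adjoint_resolvent_i(4)[OF T resolvent_graph_diff[OF T X X]])
    have "\<exists>f\<in>L2 M. (\<lambda>n. l2_norm M (\<lambda>x. X n x - f x)) \<longlonglongrightarrow> 0"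
    proof (rule L2_complete[OF L2(1)])
      fix e :: real assume "e > 0"
      then obtain N where N: "\<And>n. n \<ge> N \<Longrightarrow> l2_norm M (\<lambda>x. Y n x - y x) < e / 2"
        using order_tendstoD(2)[OF lim, of "e / 2"] by (auto simp: eventually_sequentially)
      have "l2_norm M (\<lambda>x. X m x - X n x) < e" if "m \<ge> N" "n \<ge> N" for m n
        using N[OF that(1)] N[OF that(2)] le[of m n] l2_dist_triangle[OF L2(2) y L2(2), of m n]
          l2_norm_minus_commute[of M "Y n" y] by linarith
      then show "\<exists>N. \<forall>m\<ge>N. \<forall>n\<ge>N. l2_norm M (\<lambda>x. X m x - X n x) < e"
        by blast
    qed
    then obtain f where f: "f \<in> L2 M" "(\<lambda>n. l2_norm M (\<lambda>x. X n x - f x)) \<longlonglongrightarrow> 0"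
      by blast
    have "(\<lambda>n. l2_norm M (\<lambda>x. \<i> * X n x - \<i> * f x)) \<longlonglongrightarrow> 0"
      using f(2) l2_norm_scale[of M \<i>] by (simp flip: right_diff_distrib)
    then have "(\<lambda>n. l2_norm M (\<lambda>x. (Y n x + \<i> * X n x) - (y x + \<i> * f x))) \<longlonglongrightarrow> 0"
      by (intro l2_tendsto_add L2 y lim L2_scale f)
    then have "(f, \<lambda>x. y x + \<i> * f x) \<in> T"
      using X by (intro self_adjoint_closed[OF T _ f] L2_add L2_scale y f)
        (auto simp: resolvent_graph_def)
    then show "y \<in> V"
      by (auto simp: V_def resolvent_graph_def)
  qed
  then obtain y f where yf: "(y, f) \<in> resolvent_graph T \<i>"
    and orth: "\<And>w g. (w, g) \<in> resolvent_graph T \<i> \<Longrightarrow> l2_inner M (\<lambda>x. u x - y x) w = 0"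
    unfolding V_def by blast
  note L2 = self_adjoint_resolvent_i(1-3)[OF T yf]
  define p where "p = (\<lambda>x. u x - y x)"
  have p: "p \<in> L2 M"
    unfolding p_def by (intro L2_diff u L2)
  have "(p, \<lambda>x. (-\<i>) * p x) \<in> T"
  proof (rule self_adjointI[OF T p L2_scale[OF p]])
    fix g k assume gk: "(g, k) \<in> T"
    note L2' = self_adjointD[OF T gk]
    have "l2_inner M p (\<lambda>x. 1 * k x + (-\<i>) * g x) = 0"
      using orth[of "\<lambda>x. k x - \<i> * g x" g] gk by (simp add: resolvent_graph_def p_def)
    then have "l2_inner M p k = - \<i> * l2_inner M p g"
      by (subst (asm) l2_inner_lincomb_right) (use L2' p in \<open>auto simp: add_eq_0_iff\<close>)
    then have "l2_inner M k p = \<i> * l2_inner M g p"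
      by (simp add: l2_inner_sym[of M k p] l2_inner_sym[of M g p])
    then show "l2_inner M k p = l2_inner M g (\<lambda>x. (-\<i>) * p x)"
      using l2_inner_lincomb_right[OF p p L2'(1), of "-\<i>" 0] by simp
  qed
  \<comment> \<open>Thus \<open>p\<close> is the resolvent applied to \<open>- 2 * \<i> * p\<close>.
    The identity for the imaginary part then reads
    \<open>2 * (l2_norm M p)^2 = (l2_norm M p)^2\<close>, so \<open>p\<close> is null.\<close>
  then have "((\<lambda>x. - 2 * \<i> * p x), p) \<in> resolvent_graph T \<i>"
    by (simp add: resolvent_graph_def algebra_simps)
  from self_adjoint_resolvent_i(5)[OF T this]
  have "Im (l2_inner M p (\<lambda>x. (- 2 * \<i>) * p x + 0 * p x)) = (l2_norm M p)\<^sup>2"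
    by simp
  also have "l2_inner M p (\<lambda>x. (- 2 * \<i>) * p x + 0 * p x) = 2 * \<i> * l2_inner M p p"
    by (subst l2_inner_lincomb_right) (use p in auto)
  finally have "l2_norm M p = 0"
    by (simp add: l2_inner_self)
  \<comment> \<open>The projection gives equality only almost everywhere, so the preimage of
    \<open>y\<close> is transferred to \<open>u\<close> by changing the graph pair on a null
    set.\<close>
  then have "AE x in M. y x = u x"
    using l2_norm_eq_0_iff[OF p] by (auto simp: p_def)
  then have "AE x in M. y x + \<i> * f x = u x + \<i> * f x"
    by eventually_elim simp
  moreover have "(f, \<lambda>x. y x + \<i> * f x) \<in> T"
    using yf by (simp add: resolvent_graph_def)
  ultimately have "(f, \<lambda>x. u x + \<i> * f x) \<in> T"
    using self_adjoint_AE_cong[OF T _ L2(1) L2_add[OF u L2_scale[OF L2(1)]]] by simp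
  then show ?thesis
    by (auto simp: resolvent_graph_def)
qed

section \<open>Isometries that diagonalize the resolvent\<close>

lemma linear_isometryD:
  assumes "linear_isometry M N F" "f \<in> L2 M"
  shows "F f \<in> L2 N" "l2_norm N (F f) = l2_norm M f"
  using assms by (auto simp: linear_isometry_def)

lemma linear_isometry_lincomb:
  assumes "linear_isometry M N F" "f \<in> L2 M" "g \<in> L2 M"
  shows "AE x in N. F (\<lambda>t. c * f t + d * g t) x = c * F f x + d * F g x"
  using assms by (auto simp: linear_isometry_def)

text \<open>\<open>F\<close> is linear only up to null sets, which the norm does not see.\<close>

lemma linear_isometry_norm_lincomb:
  assumes F: "linear_isometry M N F" and fg: "f \<in> L2 M" "g \<in> L2 M"
  shows "l2_norm N (\<lambda>x. c * F f x + d * F g x) = l2_norm M (\<lambda>x. c * f x + d * g x)"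
proof -
  have "l2_norm N (\<lambda>x. c * F f x + d * F g x) = l2_norm N (F (\<lambda>t. c * f t + d * g t))"
    using linear_isometry_lincomb[OF F fg]
    by (intro l2_norm_cong L2_lincomb linear_isometryD[OF F] fg) (auto simp: eq_commute)
  then show ?thesis
    using linear_isometryD(2)[OF F L2_lincomb[OF fg]] by simp
qed

lemmas linear_isometry_norm_diff =
  linear_isometry_norm_lincomb[where c = 1 and d = "-1", simplified]

lemma linear_isometry_inner:
  assumes F: "linear_isometry M N F" and fg: "f \<in> L2 M" "g \<in> L2 M"
  shows "l2_inner N (F f) (F g) = l2_inner M f g"
proof -
  have "Re (c * cnj d * l2_inner N (F f) (F g)) = Re (c * cnj d * l2_inner M f g)" for c d
    using linear_isometry_norm_lincomb[OF F fg, of c d]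
      l2_norm_lincomb_power2[OF linear_isometryD(1)[OF F fg(1)] linear_isometryD(1)[OF F fg(2)], of c d]
      l2_norm_lincomb_power2[OF fg, of c d] linear_isometryD(2)[OF F] fg
    by simp
  \<comment> \<open>Polarization: the coefficients 1 and 1 give the real part; with 1 and
    \<open>\<i>\<close> the factor \<open>cnj \<i>\<close> turns the imaginary part into a real
    part.\<close>
  from this[of 1 1] this[of 1 \<i>] show ?thesis
    by (simp add: complex_eq_iff)
qed

section \<open>The multiplier \<open>inverse (of_real l - \<i>)\<close>\<close>

lemma of_real_minus_i_nonzero: "complex_of_real l - \<i> \<noteq> 0"
  by (simp add: complex_eq_iff)

text \<open>Both sides are \<open>1 / (l^2 + 1)\<close>, as the inverse is
  \<open>(l + \<i>) / (l^2 + 1)\<close>. This is the counterpart, on the multiplication side, of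
  \<open>Im (l2_inner M f y) = (l2_norm M f)^2\<close> for the resolvent of a self-adjoint
  operator.\<close>

lemma cmod_inverse_of_real_minus_i:
  "(cmod (inverse (complex_of_real l - \<i>)))\<^sup>2 = Im (inverse (complex_of_real l - \<i>))"
  by (simp add: norm_inverse power_inverse cmod_power2) (simp add: inverse_eq_divide)

lemma cmod_inverse_of_real_minus_i_le: "cmod (inverse (complex_of_real l - \<i>)) \<le> 1"
proof -
  have "1 \<le> cmod (complex_of_real l - \<i>)"
    using abs_Im_le_cmod[of "complex_of_real l - \<i>"] by simp
  then show ?thesis
    by (simp add: norm_inverse inverse_le_1_iff)
qed

text \<open>The abstract Hilbert space situation: an isometry into an \<open>L2\<close> space over
  the line, with the resolvent formula at \<open>\<i>\<close> given only for pairs from a dense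
  class \<open>C\<close>. For the spectral transformation \<open>C\<close> is \<open>L2_c D\<close>,
  where \<open>F\<close> is given by an explicit integral.\<close>

locale diagonalized_resolvent =
  fixes M \<mu> :: "real measure" and T :: l2_graph and F :: "(real \<Rightarrow> complex) \<Rightarrow> real \<Rightarrow> complex"
    and C :: "(real \<Rightarrow> complex) set"
  assumes T: "self_adjoint M T"
    and F: "linear_isometry M \<mu> F"
    and sets_\<mu> [measurable_cong]: "sets \<mu> = sets borel"
    and C: "C \<subseteq> L2 M"
    and dense: "\<And>f e. f \<in> L2 M \<Longrightarrow> e > 0 \<Longrightarrow> \<exists>g\<in>C. l2_norm M (\<lambda>x. f x - g x) < e"
    and resolvent: "\<And>f g h. f \<in> C \<Longrightarrow> g \<in> C \<Longrightarrow> (f, h) \<in> resolvent_graph T \<i> \<Longrightarrow>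
      l2_inner M h g = (\<integral>l. inverse (of_real l - \<i>) * (F f l * cnj (F g l)) \<partial>\<mu>)"
begin

definition R :: "(real \<Rightarrow> complex) \<Rightarrow> real \<Rightarrow> complex" where
  "R G l = inverse (of_real l - \<i>) * G l"

lemma R_L2:
  assumes "G \<in> L2 \<mu>"
  shows "R G \<in> L2 \<mu>"
proof -
  note [measurable] = assms
  show ?thesis
  proof (rule L2_bound[OF assms])
    show "R G \<in> borel_measurable \<mu>"
      unfolding R_def[abs_def] by measurable
    show "cmod (R G l) \<le> cmod (G l)" for l
      using mult_right_mono[OF cmod_inverse_of_real_minus_i_le norm_ge_zero[of "G l"], of l]
      by (simp add: R_def norm_mult)
  qed
qed

lemma R_norm_le:
  assumes "G \<in> L2 \<mu>"
  shows "l2_norm \<mu> (R G) \<le> l2_norm \<mu> G"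
proof -
  have "(cmod (R G l))\<^sup>2 \<le> (cmod (G l))\<^sup>2" for l
    using mult_right_mono[OF cmod_inverse_of_real_minus_i_le norm_ge_zero[of "G l"], of l]
    by (intro power_mono) (auto simp: R_def norm_mult)
  then show ?thesis
    unfolding l2_norm_def
    by (intro real_sqrt_le_mono integral_mono L2_integrable R_L2 assms)
qed

text \<open>The first argument stays in \<open>C\<close>, while the second is released to all of
  \<open>L2 M\<close> by density, both sides being continuous in \<open>g\<close>. This allows
  \<open>g = h\<close>, where \<open>h\<close> need not belong to \<open>C\<close>.\<close>

lemma resolvent_inner:
  assumes f: "f \<in> C" and g: "g \<in> L2 M" and fh: "(f, h) \<in> resolvent_graph T \<i>"
  shows "l2_inner M h g = l2_inner \<mu> (R (F f)) (F g)"
proof -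
  note L2 = self_adjoint_resolvent_i(1,2)[OF T fh]
  have RF: "R (F f) \<in> L2 \<mu>"
    by (intro R_L2 linear_isometryD[OF F] L2)
  \<comment> \<open>\<open>B\<close> bounds the norm of the difference of the two functionals of
    \<open>g\<close>. The tolerance \<open>e / (B + 1)\<close> below also covers
    \<open>B = 0\<close>.\<close>
  define B where "B = l2_norm M h + l2_norm \<mu> (R (F f))"
  have B: "B \<ge> 0"
    by (simp add: B_def)
  have "cmod (l2_inner M h g - l2_inner \<mu> (R (F f)) (F g)) \<le> 0 + e" if e: "e > 0" for e
  proof -
    obtain g' where g': "g' \<in> C" "l2_norm M (\<lambda>x. g x - g' x) < e / (B + 1)"
      using dense[OF g, of "e / (B + 1)"] e B divide_pos_pos[of e "B + 1"] by auto
    have g'L2: "g' \<in> L2 M"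
      using g' C by auto
    note FL2 = linear_isometryD(1)[OF F g] linear_isometryD(1)[OF F g'L2]
    have "l2_inner M h g' = l2_inner \<mu> (R (F f)) (F g')"
      using resolvent[OF f g'(1) fh] by (simp add: l2_inner_def R_def mult.assoc)
    then have "l2_inner M h g - l2_inner \<mu> (R (F f)) (F g) =
        l2_inner M h (\<lambda>x. g x - g' x) - l2_inner \<mu> (R (F f)) (\<lambda>x. F g x - F g' x)"
      by (simp add: l2_inner_diff_right g g'L2 L2 RF FL2)
    also have "cmod \<dots> \<le> cmod (l2_inner M h (\<lambda>x. g x - g' x))
        + cmod (l2_inner \<mu> (R (F f)) (\<lambda>x. F g x - F g' x))"
      by (rule norm_triangle_ineq4)
    also have "\<dots> \<le> l2_norm M h * l2_norm M (\<lambda>x. g x - g' x)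
        + l2_norm \<mu> (R (F f)) * l2_norm \<mu> (\<lambda>x. F g x - F g' x)"
      by (intro add_mono l2_Cauchy_Schwarz L2_diff g g'L2 L2 RF FL2)
    also have "\<dots> = B * l2_norm M (\<lambda>x. g x - g' x)"
      by (simp add: linear_isometry_norm_diff[OF F g g'L2] B_def algebra_simps)
    also have "\<dots> \<le> B * (e / (B + 1))"
      using g'(2) B by (intro mult_left_mono) auto
    also have "\<dots> \<le> e"
      using B e by (simp add: field_simps)
    finally show ?thesis
      by simp
  qed
  then have "cmod (l2_inner M h g - l2_inner \<mu> (R (F f)) (F g)) \<le> 0"
    by (rule field_le_epsilon)
  then show ?thesis
    by simp
qed

text \<open>For \<open>h = (T - \<i>)\<^sup>-\<^sup>1 f\<close> both \<open>\<parallel>h\<parallel>\<^sup>2\<close> and \<open>\<parallel>R (F f)\<parallel>\<^sup>2\<close> are the imaginary part of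
  \<open>\<langle>h, f\<rangle>\<close>, and \<open>F h\<close> is the orthogonal projection of \<open>R (F f)\<close> to the range of \<open>F\<close>; a vector
  that has the same norm as its projection coincides with it.\<close>

lemma F_resolvent_C:
  assumes f: "f \<in> C" and fh: "(f, h) \<in> resolvent_graph T \<i>"
  shows "l2_norm \<mu> (\<lambda>l. F h l - R (F f) l) = 0"
proof -
  note L2 = self_adjoint_resolvent_i(1,2)[OF T fh]
  note FL2 = linear_isometryD(1)[OF F L2(1)] linear_isometryD(1)[OF F L2(2)]
  note RF = R_L2[OF FL2(2)]
  have "(l2_norm M h)\<^sup>2 = Im (l2_inner \<mu> (R (F f)) (F f))"
    using self_adjoint_resolvent_i(5)[OF T fh] resolvent_inner[OF f L2(2) fh] by simp
  also have "\<dots> = (\<integral>l. Im (R (F f) l * cnj (F f l)) \<partial>\<mu>)"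
    unfolding l2_inner_def by (rule integral_Im[symmetric]) (rule L2_prod_integrable[OF RF FL2(2)])
  also have "\<dots> = (\<integral>l. (cmod (R (F f) l))\<^sup>2 \<partial>\<mu>)"
  proof (rule Bochner_Integration.integral_cong[OF refl])
    fix l
    have "R (F f) l * cnj (F f l) = inverse (of_real l - \<i>) * of_real ((cmod (F f l))\<^sup>2)"
      by (simp only: R_def complex_norm_square mult.assoc)
    then have "Im (R (F f) l * cnj (F f l)) = Im (inverse (of_real l - \<i>)) * (cmod (F f l))\<^sup>2"
      by (simp del: of_real_power)
    then show "Im (R (F f) l * cnj (F f l)) = (cmod (R (F f) l))\<^sup>2"
      by (simp add: R_def norm_mult power_mult_distrib cmod_inverse_of_real_minus_i)
  qed
  also have "\<dots> = (l2_norm \<mu> (R (F f)))\<^sup>2"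
    by (simp add: l2_norm_power2)
  finally have 1: "(l2_norm M h)\<^sup>2 = (l2_norm \<mu> (R (F f)))\<^sup>2" .
  have "l2_inner \<mu> (F h) (R (F f)) = cnj (l2_inner M h h)"
    using resolvent_inner[OF f L2(1) fh] by (simp add: l2_inner_sym[of _ "F h"])
  then have "Re (l2_inner \<mu> (F h) (R (F f))) = (l2_norm M h)\<^sup>2"
    by (simp add: l2_inner_self)
  then have "(l2_norm \<mu> (\<lambda>l. F h l - R (F f) l))\<^sup>2 = 0"
    using 1 by (simp add: l2_norm_diff_power2[OF FL2(1) RF] linear_isometryD(2)[OF F L2(1)])
  then show ?thesis
    by simp
qed

text \<open>As maps of \<open>f\<close>, both \<open>F\<close> after the resolvent and
  \<open>R\<close> after \<open>F\<close> are contractions, so their agreement on the dense class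
  \<open>C\<close> extends to all of \<open>L2 M\<close>.\<close>

lemma F_resolvent:
  assumes fh: "(f, h) \<in> resolvent_graph T \<i>"
  shows "AE l in \<mu>. F h l = inverse (of_real l - \<i>) * F f l"
proof -
  note L2 = self_adjoint_resolvent_i(1,2)[OF T fh]
  note FL2 = linear_isometryD(1)[OF F L2(1)] linear_isometryD(1)[OF F L2(2)]
  have "l2_norm \<mu> (\<lambda>l. F h l - R (F f) l) \<le> 0 + e" if e: "e > 0" for e
  proof -
    obtain g where g: "g \<in> C" "l2_norm M (\<lambda>x. f x - g x) < e / 2"
      using dense[OF L2(2), of "e / 2"] half_gt_zero[OF e] by blast
    have gL2: "g \<in> L2 M"
      using g C by auto
    \<comment> \<open>Surjectivity of \<open>T - \<i>\<close> provides the resolvent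
      \<open>k\<close> of the approximant \<open>g\<close>, to which the case of \<open>C\<close>
      applies. Passing from \<open>f\<close> to \<open>g\<close> and back costs at most
      \<open>l2_norm M (\<lambda>x. f x - g x)\<close> each time, hence the choice
      \<open>e / 2\<close>.\<close>
    obtain k where gk: "(g, k) \<in> resolvent_graph T \<i>"
      using self_adjoint_resolvent_i_surj[OF T gL2] by blast
    note kL2 = self_adjoint_resolvent_i(1)[OF T gk]
    note FL2' = linear_isometryD(1)[OF F gL2] linear_isometryD(1)[OF F kL2]
    have 1: "l2_norm \<mu> (\<lambda>l. F h l - F k l) \<le> l2_norm M (\<lambda>x. f x - g x)"
    proof -
      have "l2_norm \<mu> (\<lambda>l. F h l - F k l) = l2_norm M (\<lambda>x. h x - k x)"
        by (rule linear_isometry_norm_diff[OF F L2(1) kL2])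
      also have "\<dots> \<le> l2_norm M (\<lambda>x. f x - g x)"
        by (rule self_adjoint_resolvent_i(4)[OF T resolvent_graph_diff[OF T fh gk]])
      finally show ?thesis .
    qed
    have "(\<lambda>l. R (F g) l - R (F f) l) = R (\<lambda>l. F g l - F f l)"
      by (simp add: R_def fun_eq_iff algebra_simps)
    then have 2: "l2_norm \<mu> (\<lambda>l. R (F g) l - R (F f) l) \<le> l2_norm M (\<lambda>x. f x - g x)"
      using R_norm_le[OF L2_diff[OF FL2'(1) FL2(2)]] linear_isometry_norm_diff[OF F gL2 L2(2)]
        l2_norm_minus_commute[of M g f] by simp
    show ?thesis
      using l2_dist_triangle[OF FL2(1) FL2'(2) R_L2[OF FL2(2)]]
        l2_dist_triangle[OF FL2'(2) R_L2[OF FL2'(1)] R_L2[OF FL2(2)]]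
        F_resolvent_C[OF g(1) gk] 1 2 g(2) by linarith
  qed
  then have "l2_norm \<mu> (\<lambda>l. F h l - R (F f) l) = 0"
    using field_le_epsilon[of "l2_norm \<mu> (\<lambda>l. F h l - R (F f) l)" 0] l2_norm_nonneg antisym by metis
  then show ?thesis
    using l2_norm_eq_0_iff[OF L2_diff[OF FL2(1) R_L2[OF FL2(2)]]] by (simp add: R_def)
qed

text \<open>Since \<open>f\<close> is the resolvent applied to \<open>k - \<i> f\<close>,
  multiplying the resolvent relation by \<open>l - \<i>\<close> cancels the inverse and leaves
  multiplication by \<open>l\<close>.\<close>

lemma F_intertwines:
  assumes fk: "(f, k) \<in> T"
  shows "AE l in \<mu>. F k l = of_real l * F f l"
proof -
  note L2 = self_adjointD[OF T fk]
  have "(\<lambda>x. 1 * k x + (-\<i>) * f x, f) \<in> resolvent_graph T \<i>"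
    using fk by (simp add: resolvent_graph_def)
  from F_resolvent[OF this] linear_isometry_lincomb[OF F L2(2,1), of 1 "-\<i>"]
  show ?thesis
  proof eventually_elim
    case (elim l)
    then have "(of_real l - \<i>) * F f l = F k l - \<i> * F f l"
      using of_real_minus_i_nonzero[of l] by simp
    then show ?case
      by (simp add: algebra_simps)
  qed
qed

text \<open>Relation composition applies its left factor first: \<open>F\<close>, then
  multiplication, then the adjoint of \<open>F\<close>. The forward inclusion combines intertwining
  with the fact that the adjoint of an isometry undoes it on its range. Conversely, every pair of
  the right-hand side is symmetric against \<open>T\<close>, hence lies in its adjoint, which is
  \<open>T\<close>.\<close>

theorem eq_adjoint_mult_id:
  "T = graph_of M \<mu> F O mult_id \<mu> O adjoint_graph M \<mu> (graph_of M \<mu> F)"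
proof (intro equalityI subrelI)
  fix f k assume fk: "(f, k) \<in> T"
  note L2 = self_adjointD[OF T fk]
  note FL2 = linear_isometryD(1)[OF F L2(1)] linear_isometryD(1)[OF F L2(2)]
  have "(f, F f) \<in> graph_of M \<mu> F"
    by (simp add: graph_of_def L2 FL2)
  moreover have "(F f, F k) \<in> mult_id \<mu>"
    using F_intertwines[OF fk] by (simp add: mult_id_def FL2)
  moreover have "(F k, k) \<in> adjoint_graph M \<mu> (graph_of M \<mu> F)"
  proof -
    \<comment> \<open>The graph of \<open>F\<close> contains every representative \<open>G\<close>
      of \<open>F g\<close>, so \<open>G\<close> is replaced by \<open>F g\<close> before the
      isometry property is applied.\<close>
    have "l2_inner \<mu> G (F k) = l2_inner M g k" if "(g, G) \<in> graph_of M \<mu> F" for g G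
    proof -
      have g: "g \<in> L2 M" "G \<in> L2 \<mu>" "AE l in \<mu>. G l = F g l"
        using that by (auto simp: graph_of_def)
      have "l2_inner \<mu> G (F k) = l2_inner \<mu> (F g) (F k)"
        using g by (intro l2_inner_cong FL2 linear_isometryD(1)[OF F]) auto
      then show ?thesis
        using linear_isometry_inner[OF F g(1) L2(2)] by simp
    qed
    then show ?thesis
      by (auto simp: adjoint_graph_def L2 FL2)
  qed
  ultimately show "(f, k) \<in> graph_of M \<mu> F O mult_id \<mu> O adjoint_graph M \<mu> (graph_of M \<mu> F)"
    by blast
next
  fix f k assume "(f, k) \<in> graph_of M \<mu> F O mult_id \<mu> O adjoint_graph M \<mu> (graph_of M \<mu> F)"
  then obtain G H where "(f, G) \<in> graph_of M \<mu> F" and GH: "(G, H) \<in> mult_id \<mu>"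
    and Hk: "(H, k) \<in> adjoint_graph M \<mu> (graph_of M \<mu> F)"
    by blast
  then have f: "f \<in> L2 M" and G: "G \<in> L2 \<mu>" "AE l in \<mu>. G l = F f l"
    and H: "H \<in> L2 \<mu>" "AE l in \<mu>. H l = of_real l * G l" and k: "k \<in> L2 M"
    by (auto simp: graph_of_def mult_id_def adjoint_graph_def)
  note [measurable] = G(1) H(1)
  show "(f, k) \<in> T"
  proof (rule self_adjointI[OF T f k])
    fix x y assume xy: "(x, y) \<in> T"
    note L2 = self_adjointD[OF T xy]
    note FL2 = linear_isometryD(1)[OF F L2(1)] linear_isometryD(1)[OF F L2(2)]
      linear_isometryD(1)[OF F f]
    note [measurable] = FL2
    have "(x, F x) \<in> graph_of M \<mu> F"
      by (simp add: graph_of_def L2 FL2)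
    then have "l2_inner M x k = l2_inner \<mu> (F x) H"
      using Hk by (auto simp: adjoint_graph_def)
    also have "\<dots> = l2_inner \<mu> (F y) (F f)"
      unfolding l2_inner_def
    proof (rule integral_cong_AE)
      \<comment> \<open>The factor \<open>l\<close> is real, so conjugation leaves it alone and it
        passes from \<open>H\<close> to \<open>F x\<close>, where intertwining makes it
        \<open>F y\<close>.\<close>
      show "AE l in \<mu>. F x l * cnj (H l) = F y l * cnj (F f l)"
        using F_intertwines[OF xy] G(2) H(2) by eventually_elim simp
    qed measurable
    also have "\<dots> = l2_inner M y f"
      by (rule linear_isometry_inner[OF F L2(2) f])
    finally show "l2_inner M y f = l2_inner M x k" ..
  qed
qed

end

section \<open>The spectral transformation\<close>

text \<open>Truncation to compact intervals exhausting the open one: at each point the truncation is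
  eventually exact, and the squared error is dominated by the integrable
  \<open>(cmod (f x))^2\<close>.\<close>

lemma L2_c_dense:
  assumes ab: "sl_a D < sl_b D" and f: "f \<in> L2 (sl_measure D)" and e: "e > 0"
  shows "\<exists>g\<in>L2_c D. l2_norm (sl_measure D) (\<lambda>x. f x - g x) < e"
proof -
  let ?M = "sl_measure D"
  obtain u l :: "nat \<Rightarrow> real" where ul: "sl_interval D = (\<Union>i. {l i..u i})" "incseq u" "decseq l"
    using einterval_Icc_approximation[OF ab] unfolding sl_interval_def by metis
  define g where "g n x = indicator {l n..u n} x * f x" for n x
  note [measurable] = f
  have [measurable]: "(indicator {l n..u n} :: real \<Rightarrow> complex) \<in> borel_measurable ?M" for n
  proof -
    have "(indicator {l n..u n} :: real \<Rightarrow> complex) \<in> borel_measurable lebesgue"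
      by (rule borel_measurable_indicator) simp
    then show ?thesis
      by (simp add: sl_measure_on_def measurable_restrict_space1)
  qed
  have gL2: "g n \<in> L2 ?M" for n
  proof (rule L2_bound[OF f])
    show "g n \<in> borel_measurable ?M"
      unfolding g_def[abs_def] by measurable
  qed (auto simp: g_def indicator_def)
  have "g n \<in> L2_c D" for n
    using gL2[of n] ul(1) unfolding L2_c_def
    by (auto intro!: exI[of _ "{l n..u n}"] simp: g_def)
  moreover have "(\<lambda>n. \<integral>x. (cmod (f x - g n x))\<^sup>2 \<partial>?M) \<longlonglongrightarrow> (\<integral>x. 0 \<partial>?M)"
  proof (rule integral_dominated_convergence)
    show "integrable ?M (\<lambda>x. (cmod (f x))\<^sup>2)"
      by (rule L2_integrable[OF f])
    show "(\<lambda>x. (cmod (f x - g n x))\<^sup>2) \<in> borel_measurable ?M" for n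
      using L2_measurable[OF gL2[of n]] by measurable
    show "AE x in ?M. norm ((cmod (f x - g n x))\<^sup>2) \<le> (cmod (f x))\<^sup>2" for n
      by (auto simp: g_def indicator_def)
    show "AE x in ?M. (\<lambda>n. (cmod (f x - g n x))\<^sup>2) \<longlonglongrightarrow> 0"
    proof (rule AE_I2)
      fix x assume "x \<in> space ?M"
      then have "x \<in> sl_interval D"
        by (simp add: sl_measure_on_def)
      then obtain i where "x \<in> {l i..u i}"
        using ul(1) by auto
      then have "x \<in> {l n..u n}" if "n \<ge> i" for n
        using incseqD[OF ul(2) that] decseqD[OF ul(3) that] by auto
      then have "\<forall>\<^sub>F n in sequentially. (cmod (f x - g n x))\<^sup>2 = 0"
        by (auto simp: eventually_sequentially g_def intro!: exI[of _ i])
      then show "(\<lambda>n. (cmod (f x - g n x))\<^sup>2) \<longlonglongrightarrow> 0"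
        by (rule tendsto_eventually)
    qed
  qed simp
  then have "(\<lambda>n. l2_norm ?M (\<lambda>x. f x - g n x)) \<longlonglongrightarrow> 0"
    unfolding l2_norm_def using tendsto_real_sqrt by fastforce
  then have "\<forall>\<^sub>F n in sequentially. l2_norm ?M (\<lambda>x. f x - g n x) < e"
    using e by (rule order_tendstoD(2))
  then obtain n where "l2_norm ?M (\<lambda>x. f x - g n x) < e"
    by (auto simp: eventually_sequentially)
  ultimately show ?thesis
    by blast
qed

theorem theorem9p3:
  fixes D :: sl_data
    and v :: "endpoint \<Rightarrow> real \<Rightarrow> complex"
    and \<theta> \<phi> :: "complex \<Rightarrow> real \<Rightarrow> complex"
    and m :: "complex \<Rightarrow> complex"
    and \<mu> :: "real measure"
    and \<F> :: "(real \<Rightarrow> complex) \<Rightarrow> real \<Rightarrow> complex"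
  defines "S \<equiv> sl_operator D v"
  assumes "sl_hypotheses D"
    and "\<And>e. limit_circle D e \<Longrightarrow> boundary_function D e (v e)"
    and "self_adjoint (sl_measure D) S"
    and "real_entire_system D \<theta> \<phi>"
    and "\<And>z x. x \<in> sl_interval D \<Longrightarrow> wronskian D (\<theta> z) (\<phi> z) x = 1"
    and "\<And>z. in_dom_near D v Lower (\<phi> z)"
    and "weyl_function D v \<theta> \<phi> m"
    and "spectral_measure m \<mu>"
    and "\<And>f g. f \<in> L2_c D \<Longrightarrow> g \<in> L2_c D \<Longrightarrow>
           spectral_density (sl_measure D) S f g \<mu>
             (\<lambda>l. hat D \<phi> f (of_real l) * cnj (hat D \<phi> g (of_real l)))"
    and "spectral_transformation D \<phi> \<mu> \<F>"
  shows "S = graph_of (sl_measure D) \<mu> \<F> O mult_id \<mu>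
               O adjoint_graph (sl_measure D) \<mu> (graph_of (sl_measure D) \<mu> \<F>)"
proof -
  note S = assms(4)
  have F: "linear_isometry (sl_measure D) \<mu> \<F>"
    and hat: "\<And>f. f \<in> L2_c D \<Longrightarrow> AE l in \<mu>. \<F> f l = hat D \<phi> f (of_real l)"
    using assms(11) by (auto simp: spectral_transformation_def)
  have sets_\<mu>: "sets \<mu> = sets borel"
    using assms(9) by (simp add: spectral_measure_def)
  have L2: "f \<in> L2 (sl_measure D)" if "f \<in> L2_c D" for f
    using that by (simp add: L2_c_def)
  \<comment> \<open>With \<open>L2_c D\<close> as the dense class, density comes from truncation and
    the resolvent formula from the given spectral density at \<open>z = \<i>\<close>.\<close>
  interpret diagonalized_resolvent "sl_measure D" \<mu> S \<F> "L2_c D"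
  proof
    show "\<exists>g\<in>L2_c D. l2_norm (sl_measure D) (\<lambda>x. f x - g x) < e"
      if "f \<in> L2 (sl_measure D)" "e > 0" for f e
      using assms(2) that by (intro L2_c_dense) (simp_all add: sl_hypotheses_def)
  next
    fix f g h
    assume f: "f \<in> L2_c D" and g: "g \<in> L2_c D" and h: "(f, h) \<in> resolvent_graph S \<i>"
    let ?w = "\<lambda>l. hat D \<phi> f (of_real l) * cnj (hat D \<phi> g (of_real l))"
    have w: "integrable \<mu> ?w"
      and inner: "l2_inner (sl_measure D) h g = (\<integral>l. inverse (of_real l - \<i>) * ?w l \<partial>\<mu>)"
      using assms(10)[OF f g] h by (auto simp: spectral_density_def)
    have FL2 [measurable]: "\<F> f \<in> L2 \<mu>" "\<F> g \<in> L2 \<mu>"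
      using f g by (auto intro: linear_isometryD(1)[OF F] L2)
    have [measurable]: "?w \<in> borel_measurable \<mu>"
      using w by (rule borel_measurable_integrable)
    note [measurable_cong] = sets_\<mu>
    show "l2_inner (sl_measure D) h g =
        (\<integral>l. inverse (of_real l - \<i>) * (\<F> f l * cnj (\<F> g l)) \<partial>\<mu>)"
      unfolding inner
    \<comment> \<open>The given formula is stated with \<open>hat\<close>, which agrees with
      \<open>\<F>\<close> on \<open>L2_c D\<close> only almost everywhere, so the integrands are
      compared up to null sets.\<close>
    proof (rule integral_cong_AE)
      show "AE l in \<mu>. inverse (of_real l - \<i>) * ?w l
          = inverse (of_real l - \<i>) * (\<F> f l * cnj (\<F> g l))"
        using hat[OF f] hat[OF g] by eventually_elim simp
    qed measurable
  qed (use S F sets_\<mu> L2 in auto)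
  show ?thesis
    by (rule eq_adjoint_mult_id)
qed

end
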